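(* Let $q$ be an odd prime power and $g\ge0$ an integer. For every $D\in\mathcal H_{2g+2}$, one has $$\mathcal L^*\!\left(\frac1{\sqrt q},\chi_D\right)=\sum_{\substack{f\in\mathcal A^+\\ d(f)\le g}}\frac{A_D^*(f)}{\sqrt{|f|}}+\sum_{\substack{f\in\mathcal A^+\\ d(f)\le g-1}}\frac{A_D^*(f)}{\sqrt{|f|}}.$$
   Context: $\mathcal A=\mathbb F_q[x]$; $\mathcal A^+$ is the set of monic polynomials, $\mathcal H_n$ the set of monic square-free polynomials of degree $n$; $d(f)=\deg f$, $|f|=q^{d(f)}$. For $a\in\mathcal A$ and $f\in\mathcal A^+$, $\left(\frac af\right)$ is the quadratic (Jacobi) residue symbol over $\mathcal A$, with $\left(\frac a1\right)=1$; for $D\in\mathcal H_{2g+2}$, $\chi_D(f):=\left(\frac Df\right)$ for $f\in\mathcal A^+$. $\mathcal L(u,\chi_D)=\sum_{n\ge0}\bigl(\sum_{f\in\mathcal A^+,\,d(f)=n}\chi_D(f)\bigr)u^n$ is a polynomial in $u$ vanishing at $u=1$, and the completed $L$-function is the polynomial $\mathcal L^*(u,\chi_D):=\mathcal L(u,\chi_D)/(1-u)$. The coefficients are $$A_D^*(f):=\frac1{|f|}\sum_{\substack{h\in\mathcal A^+\\ h\mid f}}|h|\,\chi_D(h).$$ An empty sum is zero. *)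

theory Defs
  imports
    "HOL-Analysis.Analysis"
    "HOL-Computational_Algebra.Computational_Algebra"
    "HOL-Number_Theory.Cong"
begin

text \<open>
  The field \<open>F_q\<close> is a type \<open>'a\<close> of class \<open>field\<close> and \<open>finite\<close>, so \<open>q = CARD('a)\<close>
  and \<open>F_q[x]\<close> is \<open>'a poly\<close>.
\<close>

definition monics :: "'a::{field,finite} poly set" where
  "monics = {f. lead_coeff f = 1}"

definition monic_squarefree :: "nat \<Rightarrow> 'a::{field,finite} poly set" where
  "monic_squarefree n = {D \<in> monics. squarefree D \<and> degree D = n}"

definition pnorm :: "'a::{field,finite} poly \<Rightarrow> real" where
  "pnorm f = real CARD('a) ^ degree f"

definition residue_symbol :: "'a::{field,finite} poly \<Rightarrow> 'a poly \<Rightarrow> int" where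
  "residue_symbol a P =
     (if P dvd a then 0 else if \<exists>b. [b ^ 2 = a] (mod P) then 1 else - 1)"

text \<open>
  The library's \<open>multiplicity\<close> is not available here: it needs the coefficient type to be a
  \<open>factorial_ring_gcd\<close>. The set below is finite for \<open>P\<close> irreducible and \<open>f\<close> nonzero.
\<close>

definition poly_multiplicity :: "'a::{field,finite} poly \<Rightarrow> 'a poly \<Rightarrow> nat" where
  "poly_multiplicity P f = Max {k. P ^ k dvd f}"

definition jacobi_symbol :: "'a::{field,finite} poly \<Rightarrow> 'a poly \<Rightarrow> int" where
  "jacobi_symbol a f =
     (\<Prod>P | P \<in> monics \<and> irreducible P \<and> P dvd f. residue_symbol a P ^ poly_multiplicity P f)"

abbreviation chi :: "'a::{field,finite} poly \<Rightarrow> 'a poly \<Rightarrow> int" where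
  "chi D f \<equiv> jacobi_symbol D f"

definition L_series :: "'a::{field,finite} poly \<Rightarrow> real fps" where
  "L_series D = Abs_fps (\<lambda>n. \<Sum>f | f \<in> monics \<and> degree f = n. of_int (chi D f))"

text \<open>
  The quotient \<open>L(u, chi_D) / (1 - u)\<close> is formed exactly, as a formal power series. For \<open>D\<close>
  monic and square-free of even degree at least 2 it is a polynomial, which is what is selected
  here; \<open>fps_of_poly\<close> is injective, so there is at most one such polynomial.
\<close>

definition L_completed :: "'a::{field,finite} poly \<Rightarrow> real poly" where
  "L_completed D = (THE p. fps_of_poly p = L_series D / (1 - fps_X))"

definition A_star :: "'a::{field,finite} poly \<Rightarrow> 'a poly \<Rightarrow> real" where
  "A_star D f = 1 / pnorm f * (\<Sum>h | h \<in> monics \<and> h dvd f. pnorm h * of_int (chi D h))"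

end

theory Submission
  imports Defs
begin

text \<open>
  Everything reduces to the functional equation \<open>a(2g - n) = q\<^bsup>g - n\<^esup> a(n)\<close> for the coefficients
  \<open>a(n)\<close> of the completed \<open>L\<close>-function, which is obtained by elementary counting, without
  reciprocity or Gauss sums. Let \<open>N(f)\<close> be the number of \<open>b\<close> mod \<open>f\<close> with \<open>f dvd b\<^sup>2 - D\<close>. Comparing
  Euler factors gives \<open>\<Sum>\<^sub>f N(f) u\<^bsup>deg f\<^esup> = Z(u) L(u) / Z(u\<^sup>2)\<close>, so the degree sums \<open>M(n)\<close> of \<open>N\<close>
  determine the \<open>a(n)\<close>. The involution \<open>(f, b) \<leftrightarrow> ((b\<^sup>2 - D) / f, b)\<close> preserves the set of pairs
  with \<open>f dvd b\<^sup>2 - D\<close>. Writing \<open>D = s\<^sup>2 + r\<close> with \<open>deg s = g + 1\<close> and \<open>deg r \<le> g\<close>, the degree of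
  \<open>b\<^sup>2 - D\<close> is read off from \<open>deg b\<close> or, when \<open>b\<close> has leading term \<open>\<plusminus>x\<^bsup>g + 1\<^esup>\<close>, from \<open>deg (b \<minusplus> s)\<close>.
  Sorting the \<open>b\<close> of degree less than \<open>n\<close> accordingly expresses \<open>M(n)\<close>, \<open>n > g\<close>, through the values of
  \<open>M\<close> at smaller arguments. In terms of \<open>a\<close> this is a three-term recurrence, symmetric under
  \<open>n \<leftrightarrow> 2g - n\<close>, which together with \<open>a(g + 1) = q a(g - 1)\<close> forces the functional equation.
\<close>

subsection \<open>Monic polynomials and residues over a finite field\<close>

lemma of_nat_CARD_eq_0: "of_nat CARD('a::{ring_1,finite}) = (0::'a)"
proof -
  have "(\<Sum>x\<in>(UNIV::'a set). x) = (\<Sum>x\<in>UNIV. x + 1)"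
    by (rule sum.reindex_bij_witness[of _ "\<lambda>x. x + 1" "\<lambda>x. x - 1"]) auto
  then show ?thesis by (simp add: sum.distrib)
qed

lemma odd_CARD_imp_two_nonzero:
  assumes "odd CARD('a::{field,finite})"
  shows "(2::'a) \<noteq> 0"
proof
  assume two: "(2::'a) = 0"
  obtain k where "CARD('a) = 2 * k + 1" using assms by (auto elim: oddE)
  then have "of_nat CARD('a) = (2::'a) * of_nat k + 1" by simp
  with two show False by (simp add: of_nat_CARD_eq_0)
qed

definition low :: "nat \<Rightarrow> 'a::zero poly set" where
  "low n = {p. \<forall>i\<ge>n. coeff p i = 0}"

lemma low_iff: "p \<in> low n \<longleftrightarrow> p = 0 \<or> degree p < n"
proof
  assume "p \<in> low n"
  then have "\<not> n \<le> degree p" if "p \<noteq> 0"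
    using that by (auto simp: low_def)
  then show "p = 0 \<or> degree p < n" by (cases "p = 0") auto
qed (auto simp: low_def coeff_eq_0)

lemma zero_in_low [simp]: "0 \<in> low n"
  by (simp add: low_def)

lemma low_0: "low 0 = {0}"
  by (auto simp: low_iff)

lemma low_add: "p \<in> low n \<Longrightarrow> q \<in> low n \<Longrightarrow> p + q \<in> low n" for p :: "'a::comm_monoid_add poly"
  by (simp add: low_def)

lemma low_diff: "p \<in> low n \<Longrightarrow> q \<in> low n \<Longrightarrow> p - q \<in> low n" for p :: "'a::ab_group_add poly"
  by (simp add: low_def)

lemma low_uminus [simp]: "- p \<in> low n \<longleftrightarrow> p \<in> low n" for p :: "'a::ab_group_add poly"
  by (simp add: low_def)

lemma low_mono: "m \<le> n \<Longrightarrow> low m \<subseteq> low n"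
  by (auto simp: low_def)

lemma low_Suc: "low (Suc n) = (\<lambda>(c, p). pCons c p) ` (UNIV \<times> low n)"
proof (intro equalityI subsetI)
  fix p :: "'a poly" assume p: "p \<in> low (Suc n)"
  obtain c r where "p = pCons c r" by (cases p) auto
  with p have "r \<in> low n" by (auto simp: low_def coeff_pCons dest: spec[of _ "Suc _"])
  with \<open>p = pCons c r\<close> show "p \<in> (\<lambda>(c, p). pCons c p) ` (UNIV \<times> low n)" by auto
qed (auto simp: low_def coeff_pCons split: nat.splits)

lemma finite_low [simp]: "finite (low n :: 'a::{zero,finite} poly set)"
  by (induction n) (auto simp: low_0 low_Suc)

lemma card_low: "card (low n :: 'a::{zero,finite} poly set) = CARD('a) ^ n"
proof (induction n)
  case (Suc n)
  have "inj_on (\<lambda>(c, p). pCons c p) (UNIV \<times> low n :: ('a \<times> 'a poly) set)"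
    by (auto simp: inj_on_def)
  then show ?case by (simp add: low_Suc card_image Suc card_cartesian_product)
qed (simp add: low_0)

lemma monic_nonzero: "f \<in> monics \<Longrightarrow> f \<noteq> 0"
  by (auto simp: monics_def)

lemma monic_mult: "f \<in> monics \<Longrightarrow> h \<in> monics \<Longrightarrow> f * h \<in> monics"
  by (simp add: monics_def lead_coeff_mult)

lemma monic_power: "f \<in> monics \<Longrightarrow> f ^ k \<in> monics"
  by (simp add: monics_def lead_coeff_power)

lemma one_monic [simp]: "1 \<in> monics"
  by (simp add: monics_def)

lemma degree_mult_monic: "f \<in> monics \<Longrightarrow> h \<in> monics \<Longrightarrow> degree (f * h) = degree f + degree h"
  by (simp add: degree_mult_eq monic_nonzero)

lemma monic_cofactor: "f * h \<in> monics \<Longrightarrow> f \<in> monics \<Longrightarrow> h \<in> monics"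
  by (simp add: monics_def lead_coeff_mult)

lemma monic_degree_0: "f \<in> monics \<Longrightarrow> degree f = 0 \<longleftrightarrow> f = 1"
  by (auto simp: monics_def elim!: degree_eq_zeroE)

lemma monic_dvd_antisym:
  assumes "f \<in> monics" "h \<in> monics" "f dvd h" "h dvd f"
  shows "f = h"
proof -
  obtain k where k: "h = f * k" using assms(3) by (auto elim: dvdE)
  then have "k \<in> monics" using assms monic_cofactor by blast
  moreover have "degree h \<le> degree f" using assms by (simp add: dvd_imp_degree_le monic_nonzero)
  ultimately have "degree k = 0" unfolding k using assms degree_mult_monic[of f k] by linarith
  with \<open>k \<in> monics\<close> have "k = 1" by (simp only: monic_degree_0)
  with k show ?thesis by simp
qed

text \<open>Degrees are indexed by integers because reflections such as \<open>2 * g - n\<close> may be negative, where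
  all the sums below vanish.\<close>

definition monics_deg :: "int \<Rightarrow> 'a::{field,finite} poly set" where
  "monics_deg n = {f \<in> monics. int (degree f) = n}"

lemma monics_deg_neg: "n < 0 \<Longrightarrow> monics_deg n = {}"
  by (auto simp: monics_deg_def)

lemma monics_deg_of_nat: "monics_deg (int n) = (\<lambda>p. monom 1 n + p) ` low n"
proof (intro equalityI subsetI)
  fix f :: "'a poly" assume f: "f \<in> monics_deg (int n)"
  then have "coeff f n = 1" "degree f = n" by (auto simp: monics_deg_def monics_def)
  then have "f - monom 1 n \<in> low n"
    by (auto simp: low_def coeff_eq_0 le_less)
  then show "f \<in> (\<lambda>p. monom 1 n + p) ` low n"
    by (intro image_eqI[of _ _ "f - monom 1 n"]) auto
next
  fix f :: "'a poly" assume "f \<in> (\<lambda>p. monom 1 n + p) ` low n"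
  then have c: "coeff f n = 1" "\<forall>i>n. coeff f i = 0" by (auto simp: low_def)
  then have "degree f = n"
    by (metis degree_le le_antisym le_degree one_neq_zero)
  with c show "f \<in> monics_deg (int n)" by (simp add: monics_deg_def monics_def)
qed

lemma finite_monics_deg [simp]: "finite (monics_deg n)"
proof (cases "n < 0")
  case False
  then obtain k where "n = int k" by (metis nonneg_int_cases not_less)
  then show ?thesis by (simp add: monics_deg_of_nat)
qed (simp add: monics_deg_neg)

lemma card_monics_deg: "card (monics_deg (int n) :: 'a::{field,finite} poly set) = CARD('a) ^ n"
proof -
  have "inj_on (\<lambda>p. monom 1 n + p) (low n :: 'a poly set)" by (auto simp: inj_on_def)
  then show ?thesis by (simp add: monics_deg_of_nat card_image card_low)
qed

lemma mod_in_low: "f \<noteq> 0 \<Longrightarrow> b mod f \<in> low (degree f)" for f :: "'a::field poly"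
  using degree_mod_less[of f b] by (simp add: low_iff)

lemma low_dvd_imp_zero: "r \<in> low (degree f) \<Longrightarrow> f dvd r \<Longrightarrow> r = 0" for f :: "'a::field poly"
  by (metis dvd_imp_degree_le leD low_iff)

lemma low_cong_unique:
  "r \<in> low (degree f) \<Longrightarrow> r' \<in> low (degree f) \<Longrightarrow> f dvd r - r' \<Longrightarrow> r = r'"
  for f :: "'a::field poly"
  using low_dvd_imp_zero[OF low_diff] by force

lemma mult_in_low_iff:
  fixes f :: "'a::field poly"
  assumes "f \<noteq> 0" "degree f \<le> e"
  shows "f * t \<in> low e \<longleftrightarrow> t \<in> low (e - degree f)"
  using assms by (cases "t = 0") (auto simp: low_iff degree_mult_eq)

lemma card_coset_periodic:
  fixes f a :: "'a::{field,finite} poly"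
  assumes f: "f \<noteq> 0" "degree f \<le> e" and per: "\<And>b t. Q (b + f * t) \<longleftrightarrow> Q b"
  shows "card {b. b - a \<in> low e \<and> Q b} = CARD('a) ^ (e - degree f) * card {r \<in> low (degree f). Q r}"
proof -
  let ?R = "{r \<in> low (degree f). Q r}" and ?L = "low (e - degree f) :: 'a poly set"
  let ?h = "\<lambda>(t, r). f * (a div f + t) + r"
  have sub: "low (degree f) \<subseteq> (low e :: 'a poly set)" using f by (intro low_mono)
  have "bij_betw ?h (?L \<times> ?R) {b. b - a \<in> low e \<and> Q b}"
    unfolding bij_betw_def
  proof (intro conjI equalityI subsetI)
    show "inj_on ?h (?L \<times> ?R)"
    proof (rule inj_onI, clarify)
      fix t r t' r' assume r: "r \<in> low (degree f)" "r' \<in> low (degree f)"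
        and eq: "f * (a div f + t) + r = f * (a div f + t') + r'"
      from eq have "r - r' = f * (t' - t)" by (simp add: algebra_simps)
      with r have "r = r'" by (intro low_cong_unique[of r f r']) auto
      with eq f show "t = t' \<and> r = r'" by simp
    qed
  next
    fix b assume "b \<in> ?h ` (?L \<times> ?R)"
    then obtain t r where b: "b = f * (a div f + t) + r" "t \<in> ?L" "r \<in> low (degree f)" "Q r" by auto
    have "b - a = f * t + r - a mod f"
      using b(1) mult_div_mod_eq[of f a] by (simp add: algebra_simps)
    moreover have "f * t \<in> low e" using b f mult_in_low_iff by blast
    ultimately have "b - a \<in> low e"
      using b(3) sub mod_in_low[OF f(1), of a] by (auto intro!: low_diff low_add)
    moreover have "Q b" using per[of r "a div f + t"] b by (simp add: add.commute)
    ultimately show "b \<in> {b. b - a \<in> low e \<and> Q b}" by simp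
  next
    fix b assume b: "b \<in> {b. b - a \<in> low e \<and> Q b}"
    have bb: "b = f * (a div f + (b div f - a div f)) + b mod f"
      by (simp add: algebra_simps)
    have "f * (b div f - a div f) = b - a + a mod f - b mod f"
      by (simp add: algebra_simps minus_mod_eq_mult_div[symmetric])
    moreover have "\<dots> \<in> low e" using b sub mod_in_low[OF f(1)] by (auto intro!: low_diff low_add)
    ultimately have "b div f - a div f \<in> ?L" using f by (metis mult_in_low_iff)
    moreover have "Q (b mod f)" using per[of "b mod f" "b div f"] b by (simp add: mod_mult_div_eq)
    ultimately show "b \<in> ?h ` (?L \<times> ?R)"
      using bb mod_in_low[OF f(1), of b]
      by (intro image_eqI[of _ _ "(b div f - a div f, b mod f)"]) auto
  qed
  then show ?thesis by (simp add: bij_betw_same_card[symmetric] card_cartesian_product card_low)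
qed

text \<open>Injectivity on the finite set of residues gives surjectivity.\<close>

lemma prime_solve_linear:
  fixes P :: "'a::{field,finite} poly"
  assumes P: "irreducible P" and a: "\<not> P dvd a"
  shows "\<exists>t. P dvd a * t - y"
proof -
  let ?h = "\<lambda>t. (a * t) mod P"
  have P0: "P \<noteq> 0" using P by auto
  have pr: "prime_elem P" using P by (rule field_poly_irreducible_imp_prime)
  have "inj_on ?h (low (degree P))"
  proof (rule inj_onI)
    fix t t' assume t: "t \<in> low (degree P)" "t' \<in> low (degree P)" and "a * t mod P = a * t' mod P"
    then have "P dvd a * (t - t')" by (metis mod_eq_dvd_iff right_diff_distrib)
    with pr a have "P dvd t - t'" by (auto simp: prime_elem_dvd_mult_iff)
    with t show "t = t'" by (rule low_cong_unique)
  qed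
  moreover have "?h ` low (degree P) \<subseteq> low (degree P)" using mod_in_low[OF P0] by auto
  ultimately have "?h ` low (degree P) = low (degree P)"
    by (intro endo_inj_surj) auto
  then obtain t where "a * t mod P = y mod P" using mod_in_low[OF P0, of y] by force
  then show ?thesis by (auto simp: mod_eq_dvd_iff)
qed

lemma divisor_double_sum:
  fixes \<phi> :: "'a::{field,finite} poly \<Rightarrow> real"
  shows "(\<Sum>f\<in>monics_deg (int n). \<Sum>h | h \<in> monics \<and> h dvd f. \<phi> h)
       = (\<Sum>m\<le>n. real CARD('a) ^ (n - m) * (\<Sum>h\<in>monics_deg (int m). \<phi> h))"
proof -
  let ?M = "\<lambda>m. monics_deg (int m) :: 'a poly set"
  have *: "{h. h \<in> monics \<and> h dvd f} = {h \<in> (\<Union>m\<le>n. ?M m). h dvd f}" if "f \<in> ?M n" for f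
    using that by (auto simp: monics_deg_def dest: dvd_imp_degree_le monic_nonzero)
  have "(\<Sum>f\<in>?M n. \<Sum>h | h \<in> monics \<and> h dvd f. \<phi> h)
      = (\<Sum>f\<in>?M n. \<Sum>h\<in>(\<Union>m\<le>n. ?M m). if h dvd f then \<phi> h else 0)"
    by (rule sum.cong[OF refl]) (simp only: *, rule sum.inter_filter, auto)
  also have "\<dots> = (\<Sum>h\<in>(\<Union>m\<le>n. ?M m). \<Sum>f\<in>?M n. if h dvd f then \<phi> h else 0)"
    by (rule sum.swap)
  also have "\<dots> = (\<Sum>m\<le>n. \<Sum>h\<in>?M m. \<Sum>f\<in>?M n. if h dvd f then \<phi> h else 0)"
  proof (rule sum.UNION_disjoint)
    show "\<forall>i\<in>{..n}. \<forall>j\<in>{..n}. i \<noteq> j \<longrightarrow> ?M i \<inter> ?M j = {}"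
      by (auto simp: monics_deg_def)
  qed simp_all
  also have "\<dots> = (\<Sum>m\<le>n. \<Sum>h\<in>?M m. real CARD('a) ^ (n - m) * \<phi> h)"
  proof (intro sum.cong refl)
    fix m h assume m: "m \<in> {..n}" and h: "h \<in> ?M m"
    have "{f \<in> ?M n. h dvd f} = (\<lambda>k. h * k) ` ?M (n - m)"
    proof (intro equalityI subsetI)
      fix f assume f: "f \<in> {f \<in> ?M n. h dvd f}"
      then obtain k where k: "f = h * k" by (auto elim: dvdE)
      with f h have "k \<in> monics" by (auto simp: monics_deg_def intro: monic_cofactor)
      with f h k have "k \<in> ?M (n - m)" by (auto simp: monics_deg_def degree_mult_monic)
      with k show "f \<in> (\<lambda>k. h * k) ` ?M (n - m)" by auto
    qed (use h m in \<open>auto simp: monics_deg_def monic_mult degree_mult_monic\<close>)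
    moreover have "inj_on (\<lambda>k. h * k) (?M (n - m))"
      using h by (auto simp: inj_on_def monics_deg_def dest: monic_nonzero)
    ultimately have "card {f \<in> ?M n. h dvd f} = CARD('a) ^ (n - m)"
      by (simp add: card_image card_monics_deg)
    then show "(\<Sum>f\<in>?M n. if h dvd f then \<phi> h else 0) = real CARD('a) ^ (n - m) * \<phi> h"
      by (simp add: sum.inter_filter[symmetric])
  qed
  finally show ?thesis by (simp add: sum_distrib_left)
qed

subsection \<open>Counting square roots of \<open>D\<close>\<close>

definition coset :: "'a::ab_group_add poly \<Rightarrow> nat \<Rightarrow> 'a poly set" where
  "coset a e = {b. b - a \<in> low e}"

lemma coset_eq_image: "coset a e = (\<lambda>r. a + r) ` low e"
  by (auto simp: coset_def intro!: image_eqI[of _ _ "_ - a"])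

lemma finite_coset [simp]: "finite (coset a e :: 'a::{ab_group_add,finite} poly set)"
  by (simp add: coset_eq_image)

lemma coset_mono: "m \<le> n \<Longrightarrow> coset a m \<subseteq> coset a n"
  using low_mono by (auto simp: coset_def)

lemma coset_zero [simp]: "coset 0 e = low e"
  by (simp add: coset_def)

lemma coset_0 [simp]: "coset a 0 = {a}"
  by (auto simp: coset_def low_0)

definition sqrt_count :: "'a::{field,finite} poly \<Rightarrow> 'a poly \<Rightarrow> nat" where
  "sqrt_count D f = card {b \<in> low (degree f). f dvd b ^ 2 - D}"

definition sqrt_sum :: "'a::{field,finite} poly \<Rightarrow> int \<Rightarrow> real" where
  "sqrt_sum D n = (\<Sum>f\<in>monics_deg n. real (sqrt_count D f))"

definition cnt :: "'a::{field,finite} poly \<Rightarrow> int \<Rightarrow> 'a poly set \<Rightarrow> real" where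
  "cnt D n B = (\<Sum>b\<in>B. real (card {f \<in> monics_deg n. f dvd b ^ 2 - D}))"

lemma sqrt_sum_neg: "n < 0 \<Longrightarrow> sqrt_sum D n = 0"
  by (simp add: sqrt_sum_def monics_deg_neg)

lemma cnt_eq:
  assumes "finite B"
  shows "cnt D n B = (\<Sum>f\<in>monics_deg n. real (card {b \<in> B. f dvd b ^ 2 - D}))"
proof -
  have "cnt D n B = (\<Sum>b\<in>B. \<Sum>f\<in>monics_deg n. if f dvd b ^ 2 - D then 1 else 0)"
    unfolding cnt_def by (intro sum.cong refl) (simp add: sum.inter_filter[symmetric])
  also have "\<dots> = (\<Sum>f\<in>monics_deg n. \<Sum>b\<in>B. if f dvd b ^ 2 - D then 1 else 0)"
    by (rule sum.swap)
  also have "\<dots> = (\<Sum>f\<in>monics_deg n. real (card {b \<in> B. f dvd b ^ 2 - D}))"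
    using assms by (intro sum.cong refl) (simp add: sum.inter_filter[symmetric])
  finally show ?thesis .
qed

lemma cnt_coset:
  fixes D :: "'a::{field,finite} poly"
  assumes "n \<le> int e"
  shows "cnt D n (coset a e) = real CARD('a) powi (int e - n) * sqrt_sum D n"
proof -
  have "real (card {b \<in> coset a e. f dvd b ^ 2 - D}) = real CARD('a) powi (int e - n) * sqrt_count D f"
    if f: "f \<in> monics_deg n" for f
  proof -
    have f0: "f \<noteq> 0" and n: "n = int (degree f)"
      using f by (auto simp: monics_deg_def dest: monic_nonzero)
    have per: "f dvd (b + f * t) ^ 2 - D \<longleftrightarrow> f dvd b ^ 2 - D" for b t
    proof -
      have "(b + f * t) ^ 2 - D = f * (t * (2 * b + f * t)) + (b ^ 2 - D)"
        by (simp add: power2_eq_square algebra_simps)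
      then show ?thesis by (simp only: dvd_add_right_iff dvd_triv_left)
    qed
    have "{b \<in> coset a e. f dvd b ^ 2 - D} = {b. b - a \<in> low e \<and> f dvd b ^ 2 - D}"
      by (simp add: coset_def)
    also have "card \<dots> = CARD('a) ^ (e - degree f) * sqrt_count D f"
      unfolding sqrt_count_def
      by (rule card_coset_periodic) (use f0 n assms per in auto)
    finally have "card {b \<in> coset a e. f dvd b ^ 2 - D} = CARD('a) ^ (e - degree f) * sqrt_count D f" .
    moreover have "real CARD('a) powi (int e - n) = real CARD('a) ^ (e - degree f)"
      using n assms by (simp add: power_int_def nat_diff_distrib)
    ultimately show ?thesis by simp
  qed
  then show ?thesis by (simp add: cnt_eq sqrt_sum_def sum_distrib_left)
qed

lemma card_divisors_sym:
  fixes y :: "'a::{field,finite} poly"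
  assumes y: "y \<noteq> 0" and N: "int (degree y) = N"
  shows "card {f \<in> monics_deg n. f dvd y} = card {f \<in> monics_deg (N - n). f dvd y}"
proof -
  define z where "z = smult (inverse (lead_coeff y)) y"
  have z: "z \<in> monics" "int (degree z) = N" and dvd: "f dvd y \<longleftrightarrow> f dvd z" for f
    using y N by (auto simp: z_def monics_def dvd_smult_iff)
  have *: "z div f \<in> {f \<in> monics_deg (N - m). f dvd y} \<and> z div (z div f) = f"
    if f: "f \<in> {f \<in> monics_deg m. f dvd y}" for f m
  proof -
    from f obtain k where k: "z = f * k" by (auto simp: dvd elim: dvdE)
    have fm: "f \<in> monics" "int (degree f) = m" using f by (auto simp: monics_deg_def)
    have km: "k \<in> monics" using k z(1) fm(1) monic_cofactor by blast
    have "z div f = k" "z div k = f" using k fm km by (auto simp: monic_nonzero)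
    moreover have "int (degree k) = N - m" using k z(2) fm km by (auto simp: degree_mult_monic)
    ultimately show ?thesis using km k by (auto simp: monics_deg_def dvd)
  qed
  have "bij_betw (\<lambda>f. z div f) {f \<in> monics_deg n. f dvd y} {f \<in> monics_deg (N - n). f dvd y}"
    by (rule bij_betwI[of _ _ _ "\<lambda>f. z div f"]) (use * *[of _ "N - n"] in auto)
  then show ?thesis by (rule bij_betw_same_card)
qed

text \<open>Exchanging \<open>f\<close> with the cofactor \<open>(b\<^sup>2 - D) / f\<close>.\<close>

lemma cnt_sym:
  assumes "\<And>b. b \<in> B \<Longrightarrow> b ^ 2 - D \<noteq> 0 \<and> int (degree (b ^ 2 - D)) = N"
  shows "cnt D n B = cnt D (N - n) B"
  unfolding cnt_def
proof (rule sum.cong[OF refl])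
  fix b assume "b \<in> B"
  then show "real (card {f \<in> monics_deg n. f dvd b ^ 2 - D})
      = real (card {f \<in> monics_deg (N - n). f dvd b ^ 2 - D})"
    using assms[of b] card_divisors_sym[of "b ^ 2 - D" N n] by presburger
qed

lemma cnt_diff: "finite B \<Longrightarrow> A \<subseteq> B \<Longrightarrow> cnt D n (B - A) = cnt D n B - cnt D n A"
  unfolding cnt_def by (rule sum_diff)

lemma cnt_shell:
  fixes D :: "'a::{field,finite} poly"
  assumes deg: "\<And>b. b - a \<noteq> 0 \<Longrightarrow> degree (b - a) = e \<Longrightarrow> b ^ 2 - D \<noteq> 0 \<and> int (degree (b ^ 2 - D)) = N"
    and k: "N - n \<le> int e"
  shows "cnt D n (coset a (Suc e)) = cnt D n (coset a e)
    + (real CARD('a) - 1) * real CARD('a) powi (int e - (N - n)) * sqrt_sum D (N - n)"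
proof -
  let ?B = "coset a (Suc e) - coset a e"
  have "cnt D n (coset a (Suc e)) - cnt D n (coset a e) = cnt D n ?B"
    by (rule cnt_diff[symmetric]) (simp_all add: coset_mono)
  also have "\<dots> = cnt D (N - n) ?B"
  proof (rule cnt_sym)
    fix b assume "b \<in> ?B"
    then have "b - a \<noteq> 0" "degree (b - a) = e" by (auto simp: coset_def low_iff)
    then show "b ^ 2 - D \<noteq> 0 \<and> int (degree (b ^ 2 - D)) = N" by (rule deg)
  qed
  also have "\<dots> = cnt D (N - n) (coset a (Suc e)) - cnt D (N - n) (coset a e)"
    by (rule cnt_diff) (simp_all add: coset_mono)
  also have "\<dots> = real CARD('a) powi (int e - (N - n) + 1) * sqrt_sum D (N - n)
      - real CARD('a) powi (int e - (N - n)) * sqrt_sum D (N - n)"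
    using k by (simp add: cnt_coset algebra_simps)
  also have "\<dots> = (real CARD('a) - 1) * real CARD('a) powi (int e - (N - n)) * sqrt_sum D (N - n)"
    by (subst power_int_add_1, simp) (simp add: algebra_simps)
  finally show ?thesis by simp
qed

lemma square_root_approx:
  fixes D :: "'a::{field,finite} poly"
  assumes two: "(2::'a) \<noteq> 0" and D: "D \<in> monics" "degree D = 2 * m"
  obtains s where "s \<in> monics" "degree s = m" "s ^ 2 - D \<in> low m"
proof -
  define X :: "'a poly" where "X = monom 1 m"
  have X: "X \<noteq> 0" "degree X = m" "coeff X m = 1" by (simp_all add: X_def degree_monom_eq)
  have X2: "X ^ 2 = monom 1 (2 * m)" by (simp add: X_def monom_power mult.commute)
  have low_div: "y div X \<in> low m" if "y \<in> low (2 * m)" for y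
  proof -
    have "X * (y div X) = y - y mod X" by (simp add: minus_mod_eq_mult_div)
    moreover have "y - y mod X \<in> low (2 * m)"
      using that mod_in_low[OF X(1), of y] X(2) low_mono[of m "2 * m"] by (intro low_diff) auto
    ultimately show ?thesis using mult_in_low_iff[of X "2 * m" "y div X"] X by simp
  qed
  have div0: "y \<in> low m" if "y div X = 0" for y
    using mod_in_low[OF X(1), of y] X(2) that mult_div_mod_eq[of X y] by simp
  let ?h = "\<lambda>p. ((X + p) ^ 2 - X ^ 2) div X"
  have "inj_on ?h (low m)"
  proof (rule inj_onI, rule ccontr)
    fix p p' assume p: "p \<in> low m" "p' \<in> low m" and eq: "?h p = ?h p'" and ne: "p \<noteq> p'"
    define z where "z = 2 * X + p + p'"
    have "coeff z m = 2" unfolding z_def mult_2 coeff_add using p X by (simp add: low_def)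
    then have z: "z \<noteq> 0" "m \<le> degree z" using two by (auto intro: le_degree)
    have "((X + p) ^ 2 - (X + p') ^ 2) div X = 0"
      using eq by (simp add: poly_div_diff_left)
    then have "(X + p) ^ 2 - (X + p') ^ 2 \<in> low m" by (rule div0)
    also have "(X + p) ^ 2 - (X + p') ^ 2 = (p - p') * z"
      by (simp add: z_def power2_eq_square algebra_simps)
    finally show False using z ne by (auto simp: low_iff degree_mult_eq)
  qed
  moreover have "?h ` low m \<subseteq> low m"
  proof clarify
    fix p :: "'a poly" assume p: "p \<in> low m"
    have "(X + p) ^ 2 - X ^ 2 = X * (p + p) + p * p"
      by (simp only: power2_eq_square ring_distribs) (simp add: algebra_simps)
    moreover have "X * (p + p) \<in> low (2 * m)"
      using mult_in_low_iff[of X "2 * m" "p + p"] X low_add[OF p p] by (simp del: mult_2_right)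
    moreover have "p * p \<in> low (2 * m)" using p by (cases "p = 0") (auto simp: low_iff degree_mult_eq)
    ultimately show "?h p \<in> low m" by (simp add: low_div low_add)
  qed
  ultimately have "?h ` low m = low m" by (intro endo_inj_surj) auto
  moreover have "(D - X ^ 2) div X \<in> low m"
  proof (rule low_div)
    show "D - X ^ 2 \<in> low (2 * m)"
      using D unfolding X2 by (auto simp: low_def monics_def coeff_eq_0 le_less)
  qed
  ultimately have "(D - X ^ 2) div X \<in> ?h ` low m" by simp
  then obtain p where p: "p \<in> low m" "?h p = (D - X ^ 2) div X" by auto
  then have "((X + p) ^ 2 - D) div X = 0" by (simp add: poly_div_diff_left)
  then have "(X + p) ^ 2 - D \<in> low m" by (rule div0)
  moreover have "X + p \<in> monics_deg (int m)" using p by (auto simp: monics_deg_of_nat X_def)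
  ultimately show ?thesis using that[of "X + p"] by (auto simp: monics_deg_def)
qed

locale square_root_expansion =
  fixes D s :: "'a::{field,finite} poly" and g :: nat
  assumes two_nonzero: "(2::'a) \<noteq> 0"
    and D_monic: "D \<in> monics" and D_sqfree: "squarefree D" and D_degree: "degree D = 2 * g + 2"
    and s_monic: "s \<in> monics" and s_degree: "degree s = g + 1"
    and s_approx: "s ^ 2 - D \<in> low (g + 1)"
begin

abbreviation M :: "int \<Rightarrow> real" where "M \<equiv> sqrt_sum D"

lemma s_not_root: "s ^ 2 \<noteq> D"
  using D_sqfree s_degree monic_nonzero[OF s_monic] unfolding squarefree_def
  by (metis Suc_eq_plus1 dvd_refl is_unit_iff_degree nat.distinct(1))

lemma cnt_s_0:
  assumes "n \<ge> int g + 1"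
  shows "cnt D n (coset s 0) = 0"
proof -
  have "{f \<in> monics_deg n. f dvd s ^ 2 - D} = {}"
    using assms s_approx s_not_root
    by (auto simp: monics_deg_def low_iff dest!: dvd_imp_degree_le)
  then show ?thesis by (simp add: cnt_def)
qed

lemma degree_near_s:
  assumes "b - s \<noteq> 0" "degree (b - s) = e" "e \<le> g"
  shows "b ^ 2 - D \<noteq> 0 \<and> int (degree (b ^ 2 - D)) = int e + int g + 1"
proof -
  define c where "c = b - s"
  define z where "z = c + 2 * s"
  have cs: "coeff s (g + 1) = 1" "coeff c (g + 1) = 0"
    using s_monic s_degree assms by (auto simp: monics_def c_def coeff_eq_0 simp del: coeff_diff)
  have "coeff z (g + 1) = 2"
    unfolding z_def mult_2 coeff_add cs by simp
  moreover have "degree z \<le> g + 1"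
    unfolding z_def mult_2 using s_degree assms c_def by (intro degree_add_le) auto
  ultimately have z: "z \<noteq> 0" "degree z = g + 1"
    using two_nonzero by (auto intro!: antisym le_degree)
  have "degree (c * z) = e + g + 1" using z assms by (simp add: degree_mult_eq c_def)
  moreover have "b ^ 2 - D = c * z + (s ^ 2 - D)"
    by (simp add: c_def z_def power2_eq_square algebra_simps)
  moreover have "degree (s ^ 2 - D) < e + g + 1" using s_approx by (auto simp: low_iff)
  ultimately have "degree (b ^ 2 - D) = e + g + 1" by (metis degree_add_eq_left)
  then show ?thesis by auto
qed

lemma cnt_s_Suc:
  assumes n: "n \<ge> int g + 1" and e: "e \<le> g"
  shows "cnt D n (coset s (Suc e)) = cnt D n (coset s e)
    + (real CARD('a) - 1) * real CARD('a) powi (n - int g - 1) * M (int e + int g + 1 - n)"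
  using cnt_shell[of s e D "int e + int g + 1" n] degree_near_s e n
  by (simp add: algebra_simps)

lemma cnt_minus_s: "cnt D n (coset (- s) e) = cnt D n (coset s e)"
proof -
  have "uminus ` coset s e = coset (- s) e"
  proof -
    have "- b - s \<in> low e \<longleftrightarrow> b + s \<in> low e" for b using low_uminus[of "b + s" e] by simp
    then have "uminus ` {b. b - s \<in> low e} = {b. b + s \<in> low e}"
      unfolding set_eq_iff image_iff mem_Collect_eq bex_simps
      by (metis add.inverse_inverse diff_minus_eq_add minus_diff_commute)
    then show ?thesis by (simp add: coset_def)
  qed
  then have "cnt D n (coset (- s) e) = cnt D n (uminus ` coset s e)" by simp
  also have "\<dots> = cnt D n (coset s e)" unfolding cnt_def by (subst sum.reindex) auto
  finally show ?thesis .
qed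

lemma cnt_low_half:
  assumes n: "n \<ge> int g + 1"
  shows "cnt D n (low (g + 2)) = (real CARD('a) - 2) * real CARD('a) powi (n - int g - 1) * M (2 * int g + 2 - n)
    + 2 * cnt D n (coset s (g + 1))"
proof -
  let ?L = "low (g + 2) :: 'a poly set" and ?S = "coset s (g + 1)" and ?T = "coset (- s) (g + 1)"
  have cs: "coeff s (g + 1) = 1" "coeff s (Suc g) = 1"
    using s_monic s_degree by (auto simp: monics_def)
  have inL: "?S \<union> ?T \<subseteq> ?L"
  proof
    fix b assume "b \<in> ?S \<union> ?T"
    then have "b - s \<in> low (g + 2) \<or> b + s \<in> low (g + 2)"
      using low_mono[of "g + 1" "g + 2"] by (auto simp: coset_def)
    moreover have "s \<in> low (g + 2)" using s_degree by (simp add: low_iff)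
    ultimately show "b \<in> ?L" by (metis add_diff_cancel_right' diff_add_cancel low_add low_diff)
  qed
  have disj: "?S \<inter> ?T = {}"
  proof (rule ccontr)
    assume "?S \<inter> ?T \<noteq> {}"
    then obtain b where b: "b - s \<in> low (g + 1)" "b + s \<in> low (g + 1)" by (auto simp: coset_def)
    have "(b + s) - (b - s) \<in> low (g + 1)" by (rule low_diff[OF b(2) b(1)])
    moreover have "(b + s) - (b - s) = s + s" by simp
    ultimately have "coeff (s + s) (g + 1) = 0" by (simp add: low_def)
    then show False unfolding coeff_add cs using two_nonzero by simp
  qed
  have split: "cnt D m ?L = cnt D m (?L - (?S \<union> ?T)) + 2 * cnt D m ?S" for m
  proof -
    have "cnt D m (?L - (?S \<union> ?T)) = cnt D m ?L - cnt D m (?S \<union> ?T)"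
      using inL by (intro cnt_diff) auto
    moreover have "cnt D m (?S \<union> ?T) = cnt D m ?S + cnt D m ?T"
      unfolding cnt_def using disj by (intro sum.union_disjoint) auto
    ultimately show ?thesis by (simp add: cnt_minus_s)
  qed
  have "cnt D n (?L - (?S \<union> ?T)) = cnt D (2 * int g + 2 - n) (?L - (?S \<union> ?T))"
  proof (rule cnt_sym)
    fix b assume b: "b \<in> ?L - (?S \<union> ?T)"
    have bl: "coeff b i = 0" if "i \<ge> g + 2" for i using b that by (auto simp: low_def)
    have sl: "coeff s i = 0" if "i \<ge> g + 2" for i using that s_degree by (simp add: coeff_eq_0)
    have "coeff b (g + 1) \<noteq> 1"
    proof
      assume "coeff b (g + 1) = 1"
      then have "coeff (b - s) i = 0" if "i \<ge> g + 1" for i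
        using bl[of i] sl[of i] cs that by (cases "i = g + 1") auto
      then show False using b by (auto simp: coset_def low_def)
    qed
    moreover have "coeff b (g + 1) \<noteq> - 1"
    proof
      assume "coeff b (g + 1) = - 1"
      then have "coeff (b + s) i = 0" if "i \<ge> g + 1" for i
        using bl[of i] sl[of i] cs that by (cases "i = g + 1") auto
      then show False using b by (auto simp: coset_def low_def)
    qed
    ultimately have "(coeff b (g + 1)) ^ 2 \<noteq> 1" by (simp add: power2_eq_1_iff)
    moreover have db: "degree b \<le> g + 1" using b by (auto simp: low_iff)
    then have "coeff (b ^ 2) (2 * (g + 1)) = (coeff b (g + 1)) ^ 2"
    proof (cases "degree b = g + 1")
      case True
      then show ?thesis using coeff_mult_degree_sum[of b b] by (simp add: power2_eq_square mult_2)
    next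
      case False
      then have "degree b < g + 1" using db by simp
      then have "degree b + degree b < 2 * (g + 1)" by simp
      with degree_mult_le[of b b] have "degree (b * b) < 2 * (g + 1)" by (rule le_less_trans)
      with False db show ?thesis by (simp add: power2_eq_square coeff_eq_0)
    qed
    moreover have "coeff D (2 * (g + 1)) = 1" using D_monic D_degree by (simp add: monics_def)
    ultimately have nz: "coeff (b ^ 2 - D) (2 * g + 2) \<noteq> 0" by simp
    moreover have "degree (b ^ 2) \<le> 2 * g + 2"
      using degree_power_le[of b 2] db by linarith
    then have "degree (b ^ 2 - D) \<le> 2 * g + 2" using D_degree by (intro degree_diff_le) auto
    ultimately have "degree (b ^ 2 - D) = 2 * g + 2" by (intro antisym le_degree)
    with nz show "b ^ 2 - D \<noteq> 0 \<and> int (degree (b ^ 2 - D)) = 2 * int g + 2" by auto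
  qed
  also have "\<dots> = cnt D (2 * int g + 2 - n) (coset 0 (g + 2)) - 2 * cnt D (2 * int g + 2 - n) ?S"
    using split by simp
  also have "\<dots> = real CARD('a) powi (n - int g - 1 + 1) * M (2 * int g + 2 - n)
      - 2 * (real CARD('a) powi (n - int g - 1) * M (2 * int g + 2 - n))"
    using n by (simp only: cnt_coset) (simp add: cnt_coset algebra_simps)
  also have "\<dots> = (real CARD('a) - 2) * real CARD('a) powi (n - int g - 1) * M (2 * int g + 2 - n)"
    by (subst power_int_add_1, simp) (simp add: algebra_simps)
  finally show ?thesis using split[of n] by simp
qed

lemma cnt_low_Suc:
  assumes "g + 2 \<le> m" "int m \<le> n"
  shows "cnt D n (low (Suc m)) = cnt D n (low m) + (real CARD('a) - 1) * real CARD('a) powi (n - int m) * M (2 * int m - n)"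
proof -
  have "b ^ 2 - D \<noteq> 0 \<and> int (degree (b ^ 2 - D)) = 2 * int m" if "b \<noteq> 0" "degree b = m" for b
  proof -
    have "degree (b ^ 2) = 2 * m" using that by (simp add: degree_power_eq)
    moreover have "degree D < 2 * m" using D_degree assms by simp
    ultimately have "degree (b ^ 2 + - D) = 2 * m" by (subst degree_add_eq_left) auto
    then show ?thesis using assms by auto
  qed
  then show ?thesis using cnt_shell[of 0 m D "2 * int m" n] assms by (simp add: algebra_simps)
qed

lemma cnt_low_self: "cnt D (int n) (low n) = M (int n)"
  using cnt_coset[of "int n" n D 0] by simp

lemma cnt_s_self: "cnt D (int g + 1) (coset s (g + 1)) = M (int g + 1)"
  using cnt_coset[of "int g + 1" "g + 1" D s] by simp

end

subsection \<open>Comparison with divisor sums of the character\<close>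

lemma exists_monic_irreducible_divisor:
  fixes f :: "'a::{field,finite} poly"
  assumes "f \<in> monics" "degree f > 0"
  obtains P where "P \<in> monics" "irreducible P" "P dvd f"
proof -
  let ?Q = "\<lambda>P. P \<in> monics \<and> P dvd f \<and> degree P > 0"
  have "?Q f" using assms by simp
  then obtain P where P: "?Q P" and min: "\<And>R. ?Q R \<Longrightarrow> degree P \<le> degree R"
    using ex_has_least_nat[of ?Q f degree] by blast
  have "irreducible P"
  proof (rule irreducibleI)
    show "P \<noteq> 0" using P monic_nonzero by blast
    then show "\<not> P dvd 1" using P by (simp add: is_unit_iff_degree)
    fix a b assume ab: "P = a * b"
    then have ab0: "a \<noteq> 0" "b \<noteq> 0" using \<open>P \<noteq> 0\<close> by auto
    show "a dvd 1 \<or> b dvd 1"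
    proof (rule ccontr)
      assume "\<not> (a dvd 1 \<or> b dvd 1)"
      then have deg: "degree a > 0" "degree b > 0" using ab0 by (auto simp: is_unit_iff_degree)
      let ?c = "smult (inverse (lead_coeff a)) a"
      have "?c dvd P" using ab0 ab by (simp add: smult_dvd_iff)
      then have "?c dvd f" using P dvd_trans by blast
      then have "?Q ?c" using deg ab0 by (simp add: monics_def)
      then have "degree P \<le> degree a" using min[of ?c] ab0 by simp
      then show False using ab deg ab0 by (simp add: degree_mult_eq)
    qed
  qed
  then show ?thesis using that P by blast
qed

lemma monic_split_power:
  fixes P f :: "'a::{field,finite} poly"
  assumes P: "P \<in> monics" "irreducible P" and f: "f \<in> monics"
  obtains k m where "f = P ^ k * m" "m \<in> monics" "\<not> P dvd m"
proof -
  have "\<exists>k m. f = P ^ k * m \<and> m \<in> monics \<and> \<not> P dvd m"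
    using f
  proof (induction "degree f" arbitrary: f rule: less_induct)
    case less
    show ?case
    proof (cases "P dvd f")
      case True
      then obtain h where h: "f = P * h" by (auto elim: dvdE)
      have hm: "h \<in> monics" using h less.prems P monic_cofactor by blast
      moreover have "degree P > 0"
        using P by (metis gr0I irreducible_not_unit is_unit_iff_degree monic_nonzero)
      ultimately have "degree h < degree f" using h P by (simp add: degree_mult_monic)
      from less.hyps[OF this hm] obtain k m where "h = P ^ k * m" "m \<in> monics" "\<not> P dvd m" by auto
      with h show ?thesis by (intro exI[of _ "Suc k"] exI[of _ m]) (simp add: mult.assoc)
    next
      case False
      with less.prems show ?thesis by (intro exI[of _ 0] exI[of _ f]) simp
    qed
  qed
  then show ?thesis using that by blast
qed

lemma monic_induct [consumes 1, case_names one split]: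
  fixes f :: "'a::{field,finite} poly"
  assumes "f \<in> monics" "Q 1"
    and step: "\<And>P k m. P \<in> monics \<Longrightarrow> irreducible P \<Longrightarrow> m \<in> monics \<Longrightarrow> \<not> P dvd m \<Longrightarrow> Q m \<Longrightarrow> Q (P ^ k * m)"
  shows "Q f"
  using assms(1)
proof (induction "degree f" arbitrary: f rule: less_induct)
  case less
  show ?case
  proof (cases "degree f = 0")
    case True
    with less.prems assms(2) show ?thesis by (simp add: monic_degree_0)
  next
    case False
    then obtain P where P: "P \<in> monics" "irreducible P" "P dvd f"
      using exists_monic_irreducible_divisor less.prems by blast
    then obtain k m where f: "f = P ^ k * m" "m \<in> monics" "\<not> P dvd m"
      using monic_split_power less.prems by blast
    have "k > 0" using P f by (cases k) auto
    moreover have "degree P > 0"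
      using P by (metis gr0I irreducible_not_unit is_unit_iff_degree monic_nonzero)
    ultimately have "degree m < degree f"
      using P f by (simp add: degree_mult_monic monic_power degree_power_eq monic_nonzero)
    then have "Q m" using less.hyps f by blast
    with step P f show ?thesis by blast
  qed
qed

lemma dvd_power_mult_cancel:
  fixes P h m :: "'a::field poly"
  assumes P: "irreducible P" and h: "\<not> P dvd h"
  shows "h dvd P ^ k * m \<Longrightarrow> h dvd m"
proof (induction k)
  case (Suc k)
  then obtain c where c: "P * (P ^ k * m) = h * c" by (auto elim: dvdE simp: mult.assoc)
  then have "P dvd h * c" by (metis dvd_triv_left)
  then have "P dvd c"
    using h field_poly_irreducible_imp_prime[OF P] by (auto simp: prime_elem_dvd_mult_iff)
  then obtain c' where "c = P * c'" by (auto elim: dvdE)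
  with c P have "P ^ k * m = h * c'" by auto
  then show ?case using Suc.IH by simp
qed simp

lemma power_dvd_power_mult:
  fixes P m :: "'a::field poly"
  assumes P: "irreducible P" and m: "\<not> P dvd m" and dvd: "P ^ j dvd P ^ k * m"
  shows "j \<le> k"
proof (rule ccontr)
  assume "\<not> j \<le> k"
  then have "P ^ Suc k dvd P ^ k * m" using dvd by (meson dvd_trans le_imp_power_dvd not_less_eq_eq)
  then have "P ^ k * P dvd P ^ k * m" by (simp add: mult.commute)
  then show False using m P by (auto simp: dvd_times_left_cancel_iff)
qed

lemma power_mult_eq_iff:
  fixes P m m' :: "'a::field poly"
  assumes "irreducible P" "\<not> P dvd m" "\<not> P dvd m'"
  shows "P ^ j * m = P ^ k * m' \<longleftrightarrow> j = k \<and> m = m'"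
proof
  assume eq: "P ^ j * m = P ^ k * m'"
  have "j = k"
    using assms eq power_dvd_power_mult[of P m' j k] power_dvd_power_mult[of P m k j]
    by (metis dvd_triv_left le_antisym)
  with eq assms show "j = k \<and> m = m'" by auto
qed simp

lemma monic_dvd_power_mult:
  fixes P m :: "'a::{field,finite} poly"
  assumes "P \<in> monics" "irreducible P" "\<not> P dvd m"
  shows "{h. h \<in> monics \<and> h dvd P ^ k * m}
       = (\<lambda>(j, h). P ^ j * h) ` ({..k} \<times> {h. h \<in> monics \<and> h dvd m})"
proof (intro equalityI subsetI)
  fix h assume h: "h \<in> {h. h \<in> monics \<and> h dvd P ^ k * m}"
  then obtain j h' where h': "h = P ^ j * h'" "h' \<in> monics" "\<not> P dvd h'"
    using monic_split_power assms by blast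
  then have "P ^ j dvd P ^ k * m" "h' dvd P ^ k * m" using h by (auto intro: dvd_mult_left dvd_mult_right)
  then have "j \<le> k" "h' dvd m" using assms h' power_dvd_power_mult dvd_power_mult_cancel by blast+
  with h' show "h \<in> (\<lambda>(j, h). P ^ j * h) ` ({..k} \<times> {h. h \<in> monics \<and> h dvd m})" by force
qed (use assms in \<open>auto intro!: monic_mult monic_power mult_dvd_mono le_imp_power_dvd\<close>)

lemma monic_square_dvd_power_mult:
  fixes P m :: "'a::{field,finite} poly"
  assumes "P \<in> monics" "irreducible P" "\<not> P dvd m"
  shows "{d. d \<in> monics \<and> d ^ 2 dvd P ^ k * m}
       = (\<lambda>(i, d). P ^ i * d) ` ({i. 2 * i \<le> k} \<times> {d. d \<in> monics \<and> d ^ 2 dvd m})"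
proof (intro equalityI subsetI)
  fix d assume d: "d \<in> {d. d \<in> monics \<and> d ^ 2 dvd P ^ k * m}"
  then obtain i d' where d': "d = P ^ i * d'" "d' \<in> monics" "\<not> P dvd d'"
    using monic_split_power assms by blast
  then have sq: "d ^ 2 = P ^ (2 * i) * d' ^ 2" by (simp add: power_mult_distrib power_mult mult.commute)
  have "\<not> P dvd d' ^ 2"
    using d' assms field_poly_irreducible_imp_prime prime_elem_dvd_power by blast
  moreover have "P ^ (2 * i) dvd P ^ k * m" "d' ^ 2 dvd P ^ k * m"
    using d sq dvd_mult_left dvd_mult_right by (simp, blast)+
  ultimately have "2 * i \<le> k" "d' ^ 2 dvd m"
    using assms power_dvd_power_mult dvd_power_mult_cancel by blast+
  with d' show "d \<in> (\<lambda>(i, d). P ^ i * d) ` ({i. 2 * i \<le> k} \<times> {d. d \<in> monics \<and> d ^ 2 dvd m})" by force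
next
  fix d assume "d \<in> (\<lambda>(i, d). P ^ i * d) ` ({i. 2 * i \<le> k} \<times> {d. d \<in> monics \<and> d ^ 2 dvd m})"
  then obtain i e where e: "d = P ^ i * e" "2 * i \<le> k" "e \<in> monics" "e ^ 2 dvd m" by auto
  then have "d ^ 2 = P ^ (2 * i) * e ^ 2" by (simp add: power_mult_distrib power_mult mult.commute)
  also have "\<dots> dvd P ^ k * m" using e by (intro mult_dvd_mono le_imp_power_dvd)
  finally show "d \<in> {d. d \<in> monics \<and> d ^ 2 dvd P ^ k * m}"
    using e assms by (simp add: monic_mult monic_power)
qed

lemma inj_on_power_mult:
  fixes P :: "'a::field poly"
  assumes "irreducible P" "\<And>h. h \<in> A \<Longrightarrow> \<not> P dvd h"
  shows "inj_on (\<lambda>(j, h). P ^ j * h) (J \<times> A)"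
  using assms by (auto simp: inj_on_def power_mult_eq_iff)

lemma finite_monic_divisors:
  fixes f :: "'a::{field,finite} poly"
  assumes "f \<noteq> 0"
  shows "finite {h. h \<in> monics \<and> h dvd f}"
proof (rule finite_subset)
  show "{h. h \<in> monics \<and> h dvd f} \<subseteq> (\<Union>n\<le>degree f. monics_deg (int n))"
    using assms by (auto simp: monics_deg_def dest: dvd_imp_degree_le)
qed simp

lemma jacobi_symbol_one: "jacobi_symbol (D :: 'a::{field,finite} poly) 1 = 1"
proof -
  have empty: "{P :: 'a poly. P \<in> monics \<and> irreducible P \<and> P dvd 1} = {}"
    using irreducible_not_unit by blast
  show ?thesis unfolding jacobi_symbol_def empty by simp
qed

lemma jacobi_symbol_power_mult:
  fixes P m :: "'a::{field,finite} poly"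
  assumes P: "P \<in> monics" "irreducible P" and m: "m \<in> monics" "\<not> P dvd m"
  shows "jacobi_symbol D (P ^ k * m) = residue_symbol D P ^ k * jacobi_symbol D m"
proof (cases "k = 0")
  case False
  let ?S = "\<lambda>f. {Q. Q \<in> monics \<and> irreducible Q \<and> Q dvd f}"
  have S: "?S (P ^ k * m) = insert P (?S m)"
  proof (intro equalityI subsetI)
    fix Q assume Q: "Q \<in> ?S (P ^ k * m)"
    show "Q \<in> insert P (?S m)"
    proof (cases "P dvd Q")
      case True
      then have "Q dvd P" using P Q
        by (metis (no_types, lifting) irreducibleD' irreducible_not_unit mem_Collect_eq)
      with True P Q have "Q = P" by (intro monic_dvd_antisym) auto
      then show ?thesis by simp
    next
      case False
      then show ?thesis using dvd_power_mult_cancel[OF P(2) False, of k m] Q by auto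
    qed
  qed (use P False in \<open>auto intro: dvd_mult2 simp: dvd_power\<close>)
  have fin: "finite (?S m)"
    by (rule finite_subset[OF _ finite_monic_divisors[of m]]) (use m monic_nonzero in auto)
  have multP: "poly_multiplicity P (P ^ k * m) = k"
  proof -
    have "{j. P ^ j dvd P ^ k * m} = {..k}"
      using power_dvd_power_mult[OF P(2) m(2)] by (auto intro: dvd_mult2 le_imp_power_dvd)
    then show ?thesis by (auto simp: poly_multiplicity_def intro!: Max_eqI)
  qed
  have multQ: "poly_multiplicity Q (P ^ k * m) = poly_multiplicity Q m" if Q: "Q \<in> ?S m" for Q
  proof -
    have "\<not> P dvd Q" using Q m dvd_trans by blast
    then have "\<not> P dvd Q ^ j" for j
      using P field_poly_irreducible_imp_prime prime_elem_dvd_power by blast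
    then have "Q ^ j dvd P ^ k * m \<longleftrightarrow> Q ^ j dvd m" for j
      using dvd_power_mult_cancel[OF P(2), of "Q ^ j" k m] dvd_mult[of "Q ^ j" m "P ^ k"] by blast
    then show ?thesis by (simp add: poly_multiplicity_def)
  qed
  have "jacobi_symbol D (P ^ k * m) = residue_symbol D P ^ k *
      (\<Prod>Q\<in>?S m. residue_symbol D Q ^ poly_multiplicity Q (P ^ k * m))"
    unfolding jacobi_symbol_def S using fin m by (simp add: multP)
  also have "(\<Prod>Q\<in>?S m. residue_symbol D Q ^ poly_multiplicity Q (P ^ k * m)) = jacobi_symbol D m"
    unfolding jacobi_symbol_def using multQ by (intro prod.cong refl) simp
  finally show ?thesis .
qed simp

lemma sqrt_count_one: "sqrt_count D 1 = 1"
proof -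
  have "{b \<in> low 0. 1 dvd b ^ 2 - D} = {0}" by (auto simp: low_0)
  then show ?thesis by (simp add: sqrt_count_def)
qed

lemma dvd_square_diff_mod:
  fixes u b D :: "'a::field poly"
  shows "u dvd (b mod u) ^ 2 - D \<longleftrightarrow> u dvd b ^ 2 - D"
  by (simp add: mod_eq_dvd_iff[symmetric] power_mod)

lemma sqrt_count_mult:
  fixes u v D :: "'a::{field,finite} poly"
  assumes nz: "u \<noteq> 0" "v \<noteq> 0" and cop: "\<And>x. u dvd x \<Longrightarrow> v dvd x \<Longrightarrow> u * v dvd x"
  shows "sqrt_count D (u * v) = sqrt_count D u * sqrt_count D v"
proof -
  let ?h = "\<lambda>b. (b mod u, b mod v)" and ?L = "low (degree (u * v)) :: 'a poly set"
  let ?R = "\<lambda>f. {b \<in> low (degree f). f dvd b ^ 2 - D}"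
  have deg: "degree (u * v) = degree u + degree v" using nz by (rule degree_mult_eq)
  have inj: "inj_on ?h ?L"
    by (rule inj_onI, rule low_cong_unique[of _ "u * v"]) (auto simp: mod_eq_dvd_iff intro: cop)
  moreover have "?h ` ?L \<subseteq> low (degree u) \<times> low (degree v)"
    using mod_in_low nz by auto
  moreover have "card (low (degree u) \<times> low (degree v) :: ('a poly \<times> 'a poly) set) = card (?h ` ?L)"
    using inj by (simp add: card_image card_low card_cartesian_product deg power_add)
  ultimately have surj: "?h ` ?L = low (degree u) \<times> low (degree v)"
    by (intro card_subset_eq) auto
  have dvd_iff: "u * v dvd x \<longleftrightarrow> u dvd x \<and> v dvd x" for x
    using cop by (auto intro: dvd_mult_left dvd_mult_right)
  have "?h ` ?R (u * v) = ?R u \<times> ?R v"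
  proof (intro equalityI subsetI)
    fix p assume "p \<in> ?h ` ?R (u * v)"
    then show "p \<in> ?R u \<times> ?R v" using mod_in_low nz by (auto simp: dvd_square_diff_mod dvd_iff)
  next
    fix p assume p: "p \<in> ?R u \<times> ?R v"
    then have "p \<in> ?h ` ?L" unfolding surj by auto
    then obtain b where "b \<in> ?L" "p = ?h b" by auto
    with p show "p \<in> ?h ` ?R (u * v)" by (auto simp: dvd_square_diff_mod dvd_iff)
  qed
  moreover have "inj_on ?h (?R (u * v))" using inj by (rule inj_on_subset) auto
  ultimately have "card (?R (u * v)) = card (?R u \<times> ?R v)" using card_image[of ?h "?R (u * v)"] by simp
  then show ?thesis by (simp add: sqrt_count_def card_cartesian_product)
qed

lemma square_root_lift:
  fixes P D b :: "'a::{field,finite} poly"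
  assumes two: "(2::'a) \<noteq> 0" and P: "irreducible P" and D: "\<not> P dvd D" and b: "P dvd b ^ 2 - D"
  shows "\<exists>c. P ^ Suc k dvd c ^ 2 - D"
proof (induction k)
  case (Suc k)
  then obtain c y where c: "c ^ 2 - D = P ^ Suc k * y" by (auto elim: dvdE)
  have "\<not> P dvd 2 * c"
  proof
    assume "P dvd 2 * c"
    moreover have "2 * c = smult 2 c" by (simp add: numeral_mult_conv_smult)
    ultimately have "P dvd c" using two by (simp add: dvd_smult_iff)
    then have "P dvd c ^ 2" by (simp add: power2_eq_square)
    moreover have "P dvd c ^ 2 - D" unfolding c by simp
    ultimately have "P dvd c ^ 2 - (c ^ 2 - D)" by (rule dvd_diff)
    with D show False by simp
  qed
  then obtain t where t: "P dvd 2 * c * t - (- y)" using prime_solve_linear[OF P] by blast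
  have "(c + P ^ Suc k * t) ^ 2 - D = (c ^ 2 - D) + P ^ Suc k * (2 * c * t) + P ^ Suc k * (P ^ Suc k * t ^ 2)"
    by (simp add: power2_eq_square algebra_simps)
  also have "\<dots> = P ^ Suc k * ((2 * c * t - (- y)) + P ^ Suc k * t ^ 2)"
    unfolding c by (simp add: algebra_simps)
  also have "P ^ Suc k * P dvd \<dots>"
    using t by (intro mult_dvd_mono dvd_add) auto
  finally show ?case by (metis power_Suc2)
qed (use b in auto)

lemma sqrt_count_prime_power:
  fixes P D :: "'a::{field,finite} poly"
  assumes two: "(2::'a) \<noteq> 0" and D: "squarefree D" and P: "irreducible P"
  shows "int (sqrt_count D (P ^ Suc k)) = residue_symbol D P ^ k * (1 + residue_symbol D P)"
proof -
  let ?R = "{b \<in> low (degree (P ^ Suc k)). P ^ Suc k dvd b ^ 2 - D}"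
  have pr: "prime_elem P" using P by (rule field_poly_irreducible_imp_prime)
  have P0: "P ^ Suc k \<noteq> 0" using P by auto
  have PD: "P dvd P ^ Suc k" by simp
  consider "P dvd D" | "\<not> P dvd D" "\<nexists>b. P dvd b ^ 2 - D" | b where "\<not> P dvd D" "P dvd b ^ 2 - D" by blast
  then show ?thesis
  proof cases
    case 1
    have Pb: "P dvd b" if "P dvd b ^ 2 - D" for b
    proof -
      have "P dvd (b ^ 2 - D) + D" using that 1 by (rule dvd_add)
      then show ?thesis using pr prime_elem_dvd_power by auto
    qed
    show ?thesis
    proof (cases "k = 0")
      case True
      have "?R = {0}"
      proof (intro equalityI subsetI)
        fix b assume "b \<in> ?R"
        then have "b \<in> low (degree P)" "P dvd b ^ 2 - D" using True by simp_all
        then show "b \<in> {0}" using low_dvd_imp_zero Pb by blast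
      qed (use True 1 in simp)
      then have "sqrt_count D (P ^ Suc k) = 1" unfolding sqrt_count_def by simp
      with True 1 show ?thesis by (simp add: residue_symbol_def)
    next
      case False
      have "\<not> P ^ Suc k dvd b ^ 2 - D" for b
      proof
        assume *: "P ^ Suc k dvd b ^ 2 - D"
        then have "P dvd b" using Pb PD dvd_trans by blast
        then have "P ^ 2 dvd b ^ 2" by (rule dvd_power_same)
        moreover have "P ^ 2 dvd b ^ 2 - D"
          by (rule dvd_trans[OF le_imp_power_dvd *]) (use False in simp)
        ultimately have "P ^ 2 dvd b ^ 2 - (b ^ 2 - D)" by (rule dvd_diff)
        then have "P dvd 1" using D by (simp add: squarefree_def)
        then show False using P irreducible_not_unit by blast
      qed
      then have "sqrt_count D (P ^ Suc k) = 0" unfolding sqrt_count_def by simp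
      with False 1 show ?thesis by (simp add: residue_symbol_def)
    qed
  next
    case 2
    then have "\<not> P ^ Suc k dvd b ^ 2 - D" for b using PD dvd_trans by blast
    then have "sqrt_count D (P ^ Suc k) = 0" unfolding sqrt_count_def by simp
    with 2 show ?thesis by (simp add: residue_symbol_def cong_iff_dvd_diff)
  next
    case (3 b0)
    then obtain c where c: "P ^ Suc k dvd c ^ 2 - D" using square_root_lift[OF two P] by blast
    have Pc: "\<not> P dvd c"
    proof
      assume "P dvd c"
      then have "P dvd c ^ 2" by (simp add: power2_eq_square)
      moreover have "P dvd c ^ 2 - D" using c PD dvd_trans by blast
      ultimately have "P dvd c ^ 2 - (c ^ 2 - D)" by (rule dvd_diff)
      with 3 show False by simp
    qed
    have cs: "c + c = smult 2 c" by (simp add: numeral_mult_conv_smult flip: mult_2)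
    have cc: "\<not> P dvd c + c" unfolding cs using two Pc by (simp add: dvd_smult_iff)
    have "?R = {c mod P ^ Suc k, - c mod P ^ Suc k}"
    proof (intro equalityI subsetI)
      fix b assume b: "b \<in> ?R"
      have "P ^ Suc k dvd b ^ 2 - D" using b by simp
      then have "P ^ Suc k dvd (b ^ 2 - D) - (c ^ 2 - D)" using c by (rule dvd_diff)
      then have "P ^ Suc k dvd (b - c) * (b + c)" by (simp add: power2_eq_square algebra_simps)
      then obtain i j where ij: "i + j = Suc k" "P ^ i dvd b - c" "P ^ j dvd b + c"
        using prime_elem_power_dvd_prod[OF _ pr] by blast
      have "i = 0 \<or> j = 0"
      proof (rule ccontr)
        assume "\<not> (i = 0 \<or> j = 0)"
        then have "P dvd b - c" "P dvd b + c"
          using ij by (meson dvd_power dvd_trans neq0_conv)+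
        then have "P dvd (b + c) - (b - c)" using dvd_diff by blast
        moreover have "(b + c) - (b - c) = c + c" by simp
        ultimately show False using cc by metis
      qed
      with ij have "P ^ Suc k dvd b - c \<or> P ^ Suc k dvd b - (- c)" by auto
      then have "b mod P ^ Suc k = c mod P ^ Suc k \<or> b mod P ^ Suc k = - c mod P ^ Suc k"
        by (simp only: mod_eq_dvd_iff)
      moreover have "b mod P ^ Suc k = b"
        using b by (auto simp: low_iff intro: mod_poly_less)
      ultimately show "b \<in> {c mod P ^ Suc k, - c mod P ^ Suc k}" by auto
    next
      fix b assume "b \<in> {c mod P ^ Suc k, - c mod P ^ Suc k}"
      then consider "b = c mod P ^ Suc k" | "b = (- c) mod P ^ Suc k" by blast
      then show "b \<in> ?R"
      proof cases
        case 1
        then show ?thesis using mod_in_low[OF P0, of c] c dvd_square_diff_mod[of "P ^ Suc k" c D] by blast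
      next
        case 2
        then show ?thesis
          using mod_in_low[OF P0, of "- c"] c dvd_square_diff_mod[of "P ^ Suc k" "- c" D]
          by (metis (no_types, lifting) mem_Collect_eq power2_minus)
      qed
    qed
    moreover have "c mod P ^ Suc k \<noteq> - c mod P ^ Suc k"
    proof
      assume "c mod P ^ Suc k = - c mod P ^ Suc k"
      then have "P ^ Suc k dvd c - (- c)" by (simp only: mod_eq_dvd_iff)
      then have "P dvd c + c" using PD dvd_trans by (metis diff_minus_eq_add)
      with cc show False by blast
    qed
    ultimately have "sqrt_count D (P ^ Suc k) = 2" unfolding sqrt_count_def by simp
    moreover have "residue_symbol D P = 1" using 3 by (auto simp: residue_symbol_def cong_iff_dvd_diff)
    ultimately show ?thesis by simp
  qed
qed

lemma prime_power_divisor_sum: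
  fixes P D :: "'a::{field,finite} poly"
  assumes "(2::'a) \<noteq> 0" "squarefree D" "irreducible P"
  shows "(\<Sum>j\<le>k. residue_symbol D P ^ j) = (\<Sum>i | 2 * i \<le> k. int (sqrt_count D (P ^ (k - 2 * i))))"
proof (induction k rule: induct_nat_012)
  case 0
  have "{i::nat. 2 * i \<le> 0} = {0}" by auto
  then show ?case by (simp add: sqrt_count_one)
next
  case 1
  have "{i::nat. 2 * i \<le> Suc 0} = {0}" by auto
  then show ?case using sqrt_count_prime_power[OF assms, of 0] by simp
next
  case (ge2 k)
  have eq: "{i. 2 * i \<le> Suc (Suc k)} = insert 0 (Suc ` {i. 2 * i \<le> k})"
  proof (intro equalityI subsetI)
    fix i assume "i \<in> {i. 2 * i \<le> Suc (Suc k)}"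
    then show "i \<in> insert 0 (Suc ` {i. 2 * i \<le> k})" by (cases i) auto
  qed auto
  have fin: "finite {i. 2 * i \<le> k}" by (rule finite_subset[of _ "{..k}"]) auto
  have "(\<Sum>i | 2 * i \<le> Suc (Suc k). int (sqrt_count D (P ^ (Suc (Suc k) - 2 * i))))
      = int (sqrt_count D (P ^ Suc (Suc k))) + (\<Sum>i | 2 * i \<le> k. int (sqrt_count D (P ^ (k - 2 * i))))"
    unfolding eq using fin by (subst sum.insert) (auto simp: sum.reindex)
  then show ?case
    using ge2 sqrt_count_prime_power[OF assms, of "Suc k"] by (simp add: algebra_simps)
qed

text \<open>The arithmetic form of \<open>\<Sum>\<^sub>f N(f) u\<^bsup>deg f\<^esup> = Z(u) L(u) / Z(u\<^sup>2)\<close>, where \<open>N(f)\<close> counts the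
  square roots of \<open>D\<close> modulo \<open>f\<close>.\<close>

lemma chi_divisor_sum:
  fixes D f :: "'a::{field,finite} poly"
  assumes D: "(2::'a) \<noteq> 0" "squarefree D" and f: "f \<in> monics"
  shows "(\<Sum>h | h \<in> monics \<and> h dvd f. chi D h)
       = (\<Sum>d | d \<in> monics \<and> d ^ 2 dvd f. int (sqrt_count D (f div d ^ 2)))"
  using f
proof (induction rule: monic_induct)
  case one
  have "{h :: 'a poly. h \<in> monics \<and> h dvd 1} = {1}"
    by (auto intro: monic_dvd_antisym)
  moreover have "{d :: 'a poly. d \<in> monics \<and> d ^ 2 dvd 1} = {1}"
    by (auto intro: monic_dvd_antisym simp: is_unit_power_iff)
  ultimately show ?case by (simp add: jacobi_symbol_one sqrt_count_one)
next
  case (split P k m)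
  let ?H = "{h. h \<in> monics \<and> h dvd m}" and ?E = "{d. d \<in> monics \<and> d ^ 2 dvd m}"
  have H: "\<not> P dvd h" if "h \<in> ?H" for h using that split dvd_trans by blast
  have E: "\<not> P dvd d" if "d \<in> ?E" for d
    using that split dvd_trans[of P d m] dvd_trans[of d "d ^ 2" m] by (auto simp: power2_eq_square)
  have "(\<Sum>h | h \<in> monics \<and> h dvd P ^ k * m. chi D h) = (\<Sum>(j, h)\<in>{..k} \<times> ?H. chi D (P ^ j * h))"
    unfolding monic_dvd_power_mult[OF split(1,2,4)]
    by (subst sum.reindex[OF inj_on_power_mult[OF split(2) H]]) (auto simp: case_prod_unfold)
  also have "\<dots> = (\<Sum>(j, h)\<in>{..k} \<times> ?H. residue_symbol D P ^ j * chi D h)"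
    using split(1,2) H by (intro sum.cong refl) (auto simp: jacobi_symbol_power_mult)
  also have "\<dots> = (\<Sum>j\<le>k. residue_symbol D P ^ j) * (\<Sum>h\<in>?H. chi D h)"
    by (simp add: sum_product sum.cartesian_product)
  also have "\<dots> = (\<Sum>i | 2 * i \<le> k. int (sqrt_count D (P ^ (k - 2 * i))))
      * (\<Sum>d\<in>?E. int (sqrt_count D (m div d ^ 2)))"
    by (simp add: prime_power_divisor_sum[OF D split(2)] split(5))
  also have "\<dots> = (\<Sum>(i, d)\<in>{i. 2 * i \<le> k} \<times> ?E.
      int (sqrt_count D (P ^ (k - 2 * i))) * int (sqrt_count D (m div d ^ 2)))"
    by (simp add: sum_product sum.cartesian_product)
  also have "\<dots> = (\<Sum>(i, d)\<in>{i. 2 * i \<le> k} \<times> ?E. int (sqrt_count D (P ^ k * m div (P ^ i * d) ^ 2)))"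
  proof (intro sum.cong refl, clarify)
    fix i d assume i: "2 * i \<le> k" and d: "d \<in> monics" "d ^ 2 dvd m"
    obtain c where c: "m = d ^ 2 * c" using d by (auto elim: dvdE)
    have c0: "c \<noteq> 0" "d ^ 2 \<noteq> 0" using c split(3) by (auto dest: monic_nonzero)
    have Pc: "\<not> P dvd c" using c split(4) by (auto intro: dvd_mult)
    have "P ^ k = P ^ (2 * i) * P ^ (k - 2 * i)" using i by (simp flip: power_add)
    then have "P ^ k * m = (P ^ i * d) ^ 2 * (P ^ (k - 2 * i) * c)"
      by (simp add: c power_mult_distrib power_mult mult.commute mult.left_commute)
    moreover have "(P ^ i * d) ^ 2 \<noteq> 0" using c0 split(2) by auto
    ultimately have "P ^ k * m div (P ^ i * d) ^ 2 = P ^ (k - 2 * i) * c"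
      by (metis nonzero_mult_div_cancel_left)
    moreover have "m div d ^ 2 = c" using c c0 by simp
    moreover have "sqrt_count D (P ^ (k - 2 * i) * c) = sqrt_count D (P ^ (k - 2 * i)) * sqrt_count D c"
    proof (rule sqrt_count_mult)
      fix x assume x: "P ^ (k - 2 * i) dvd x" "c dvd x"
      then obtain y where y: "x = P ^ (k - 2 * i) * y" by (auto elim: dvdE)
      with x Pc have "c dvd y" using dvd_power_mult_cancel[OF split(2)] by blast
      with y show "P ^ (k - 2 * i) * c dvd x" by (simp add: mult_dvd_mono)
    qed (use c0 split(2) in auto)
    ultimately show "int (sqrt_count D (P ^ (k - 2 * i))) * int (sqrt_count D (m div d ^ 2))
        = int (sqrt_count D (P ^ k * m div (P ^ i * d) ^ 2))" by simp
  qed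
  also have "\<dots> = (\<Sum>d | d \<in> monics \<and> d ^ 2 dvd P ^ k * m. int (sqrt_count D (P ^ k * m div d ^ 2)))"
    unfolding monic_square_dvd_power_mult[OF split(1,2,4)]
    by (subst sum.reindex[OF inj_on_power_mult[OF split(2) E]]) (auto simp: case_prod_unfold)
  finally show ?case .
qed

lemma square_divisor_double_sum:
  fixes \<phi> :: "'a::{field,finite} poly \<Rightarrow> real"
  shows "(\<Sum>f\<in>monics_deg (int n). \<Sum>d | d \<in> monics \<and> d ^ 2 dvd f. \<phi> (f div d ^ 2))
       = (\<Sum>i | 2 * i \<le> n. real CARD('a) ^ i * (\<Sum>f\<in>monics_deg (int (n - 2 * i)). \<phi> f))"
proof -
  let ?M = "\<lambda>m. monics_deg (int m) :: 'a poly set"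
  let ?I = "{i. 2 * i \<le> n}"
  have fin: "finite ?I" by (rule finite_subset[of _ "{..n}"]) auto
  have fin2: "finite {d. d \<in> monics \<and> d ^ 2 dvd f}" if "f \<in> ?M n" for f
    by (rule finite_subset[OF _ finite_monic_divisors[of f]])
      (use that in \<open>auto simp: monics_deg_def dest: monic_nonzero intro: dvd_trans[OF dvd_power]\<close>)
  have "(\<Sum>f\<in>?M n. \<Sum>d | d \<in> monics \<and> d ^ 2 dvd f. \<phi> (f div d ^ 2))
      = (\<Sum>(f, d)\<in>(SIGMA f:?M n. {d. d \<in> monics \<and> d ^ 2 dvd f}). \<phi> (f div d ^ 2))"
    using fin2 by (intro sum.Sigma) auto
  also have "\<dots> = (\<Sum>(i, d, m)\<in>(SIGMA i:?I. ?M i \<times> ?M (n - 2 * i)). \<phi> m)"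
  proof (rule sum.reindex_bij_witness[of _ "\<lambda>(i, d, m). (d ^ 2 * m, d)" "\<lambda>(f, d). (degree d, d, f div d ^ 2)"],
      goal_cases)
    case (1 p)
    then show ?case by (auto dest!: dvd_mult_div_cancel)
  next
    case (2 p)
    then obtain f d where p: "p = (f, d)" and f: "f \<in> monics" "degree f = n" and d: "d \<in> monics" "d ^ 2 dvd f"
      by (auto simp: monics_deg_def)
    obtain c where c: "f = d ^ 2 * c" using d by (auto elim: dvdE)
    then have "c \<in> monics" using f d by (meson monic_cofactor monic_power)
    moreover have "degree f = 2 * degree d + degree c"
      using c d \<open>c \<in> monics\<close> by (simp add: degree_mult_monic monic_power degree_power_eq monic_nonzero)
    moreover have "f div d ^ 2 = c" using c d by (simp add: monic_nonzero)
    ultimately show ?case using p f d by (auto simp: monics_deg_def)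
  next
    case (3 p)
    then show ?case by (auto simp: monics_deg_def dest: monic_nonzero)
  next
    case (4 p)
    then show ?case
      by (auto simp: monics_deg_def degree_mult_monic monic_mult monic_power degree_power_eq monic_nonzero)
  next
    case (5 p)
    then show ?case by auto
  qed
  also have "\<dots> = (\<Sum>i\<in>?I. \<Sum>(d, m)\<in>?M i \<times> ?M (n - 2 * i). \<phi> m)"
    using fin by (subst sum.Sigma) (auto simp: case_prod_unfold)
  also have "\<dots> = (\<Sum>i\<in>?I. real CARD('a) ^ i * (\<Sum>m\<in>?M (n - 2 * i). \<phi> m))"
    by (intro sum.cong refl) (simp add: card_monics_deg flip: sum.cartesian_product)
  finally show ?thesis .
qed

subsection \<open>The functional equation\<close>

definition chi_sum :: "'a::{field,finite} poly \<Rightarrow> int \<Rightarrow> real" where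
  "chi_sum D n = (\<Sum>f\<in>monics_deg n. of_int (chi D f))"

definition chi_divisor_total :: "'a::{field,finite} poly \<Rightarrow> int \<Rightarrow> real" where
  "chi_divisor_total D n = (\<Sum>f\<in>monics_deg n. \<Sum>h | h \<in> monics \<and> h dvd f. of_int (chi D h))"

definition L_star_coeff :: "'a::{field,finite} poly \<Rightarrow> int \<Rightarrow> real" where
  "L_star_coeff D n = (\<Sum>m\<in>{0..n}. chi_sum D m)"

lemma chi_divisor_total_neg: "n < 0 \<Longrightarrow> chi_divisor_total D n = 0"
  by (simp add: chi_divisor_total_def monics_deg_neg)

lemma L_star_coeff_neg: "n < 0 \<Longrightarrow> L_star_coeff D n = 0"
  by (simp add: L_star_coeff_def)

lemma L_star_coeff_diff: "L_star_coeff D n - L_star_coeff D (n - 1) = chi_sum D n"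
proof (cases "n < 0")
  case True
  then show ?thesis by (simp add: L_star_coeff_neg chi_sum_def monics_deg_neg)
next
  case False
  then have "{0..n} = insert n {0..n - 1}" by auto
  then show ?thesis by (simp add: L_star_coeff_def)
qed

lemma chi_divisor_total_eq:
  fixes D :: "'a::{field,finite} poly"
  shows "chi_divisor_total D (int n) = (\<Sum>m\<le>n. real CARD('a) ^ (n - m) * chi_sum D (int m))"
  unfolding chi_divisor_total_def chi_sum_def by (rule divisor_double_sum)

lemma chi_divisor_total_rec:
  fixes D :: "'a::{field,finite} poly"
  shows "chi_divisor_total D n - real CARD('a) * chi_divisor_total D (n - 1)
    = L_star_coeff D n - L_star_coeff D (n - 1)"
proof -
  consider "n < 0" | "n = 0" | k where "n = int (Suc k)"
  proof (cases "n \<le> 0")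
    case False
    then have "n = int (Suc (nat (n - 1)))" by simp
    then show ?thesis by (rule that(3))
  qed (use that in fastforce)
  then have "chi_divisor_total D n - real CARD('a) * chi_divisor_total D (n - 1) = chi_sum D n"
  proof cases
    case 1
    then show ?thesis by (simp add: chi_divisor_total_neg chi_sum_def monics_deg_neg)
  next
    case 2
    then show ?thesis using chi_divisor_total_eq[of D 0] by (simp add: chi_divisor_total_neg)
  next
    case 3
    have "(\<Sum>m\<le>k. real CARD('a) ^ (Suc k - m) * chi_sum D (int m))
        = real CARD('a) * chi_divisor_total D (int k)"
      unfolding chi_divisor_total_eq sum_distrib_left
      by (intro sum.cong refl) (simp add: Suc_diff_le)
    moreover have "n - 1 = int k" using 3 by simp
    ultimately show ?thesis
      using chi_divisor_total_eq[of D "Suc k"] by (simp only: 3 sum.atMost_Suc) simp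
  qed
  then show ?thesis by (simp add: L_star_coeff_diff)
qed

lemma chi_divisor_total_eq_sqrt_sum:
  fixes D :: "'a::{field,finite} poly"
  assumes "(2::'a) \<noteq> 0" "squarefree D"
  shows "chi_divisor_total D (int n)
    = (\<Sum>i | 2 * i \<le> n. real CARD('a) ^ i * sqrt_sum D (int (n - 2 * i)))"
proof -
  have "chi_divisor_total D (int n)
      = (\<Sum>f\<in>monics_deg (int n). of_int (\<Sum>h | h \<in> monics \<and> h dvd f. chi D h))"
    by (simp add: chi_divisor_total_def)
  also have "\<dots> = (\<Sum>f\<in>monics_deg (int n). \<Sum>d | d \<in> monics \<and> d ^ 2 dvd f. real (sqrt_count D (f div d ^ 2)))"
    using assms by (intro sum.cong refl) (simp add: chi_divisor_sum monics_deg_def)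
  also have "\<dots> = (\<Sum>i | 2 * i \<le> n. real CARD('a) ^ i * sqrt_sum D (int (n - 2 * i)))"
    unfolding sqrt_sum_def by (rule square_divisor_double_sum)
  finally show ?thesis .
qed

lemma sqrt_sum_eq:
  fixes D :: "'a::{field,finite} poly"
  assumes "(2::'a) \<noteq> 0" "squarefree D"
  shows "sqrt_sum D n = chi_divisor_total D n - real CARD('a) * chi_divisor_total D (n - 2)"
proof -
  note eq = chi_divisor_total_eq_sqrt_sum[OF assms]
  consider "n < 0" | k where "n = int k" "k < 2" | k where "n = int (Suc (Suc k))"
  proof (cases "n < 2")
    case True
    then show ?thesis using that(1) that(2)[of "nat n"] by (cases "n < 0") auto
  next
    case False
    then have "n = int (Suc (Suc (nat (n - 2))))" by simp
    then show ?thesis by (rule that(3))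
  qed
  then show ?thesis
  proof cases
    case 1
    then show ?thesis by (simp add: chi_divisor_total_neg sqrt_sum_neg)
  next
    case 2
    have "{i::nat. 2 * i \<le> k} = {0}" using 2 by auto
    then show ?thesis using 2 eq[of k] by (simp add: chi_divisor_total_neg)
  next
    case 3
    have split: "{i. 2 * i \<le> Suc (Suc k)} = insert 0 (Suc ` {i. 2 * i \<le> k})"
    proof (intro equalityI subsetI)
      fix i assume "i \<in> {i. 2 * i \<le> Suc (Suc k)}"
      then show "i \<in> insert 0 (Suc ` {i. 2 * i \<le> k})" by (cases i) auto
    qed auto
    have fin: "finite {i. 2 * i \<le> k}" by (rule finite_subset[of _ "{..k}"]) auto
    have "chi_divisor_total D n = sqrt_sum D n + real CARD('a) * chi_divisor_total D (int k)"
      unfolding 3 eq split using fin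
      by (subst sum.insert) (auto simp: sum.reindex sum_distrib_left mult.assoc)
    moreover have "n - 2 = int k" using 3 by simp
    ultimately show ?thesis by simp
  qed
qed

context square_root_expansion
begin

abbreviation W :: "int \<Rightarrow> real" where "W \<equiv> chi_divisor_total D"
abbreviation a :: "int \<Rightarrow> real" where "a \<equiv> L_star_coeff D"

lemma W_rec: "W n = real CARD('a) * W (n - 1) + a n - a (n - 1)"
  using chi_divisor_total_rec[of D n] by simp

lemma M_eq: "M n = W n - real CARD('a) * W (n - 2)"
  using sqrt_sum_eq[OF two_nonzero D_sqfree] .

lemma cnt_s:
  assumes n: "n \<ge> int g + 1"
  shows "e \<le> g + 1 \<Longrightarrow> cnt D n (coset s e) = (real CARD('a) - 1) * real CARD('a) powi (n - int g - 1)
    * (W (int e + int g - n) + a (int e + int g - n - 1))"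
proof (induction e)
  case 0
  then show ?case using n cnt_s_0[OF n] by (simp add: chi_divisor_total_neg L_star_coeff_neg)
next
  case (Suc e)
  let ?j = "int e + int g - n"
  have "W j + a (j - 1) + M (j + 1) = W (j + 1) + a j" for j
    using M_eq[of "j + 1"] W_rec[of j] by simp
  then have "W ?j + a (?j - 1) + M (?j + 1) = W (?j + 1) + a ?j" .
  moreover have "int (Suc e) + int g - n = ?j + 1" "int (Suc e) + int g - n - 1 = ?j"
    "int e + int g + 1 - n = ?j + 1" by auto
  ultimately show ?case
    using Suc cnt_s_Suc[OF n, of e] by (simp only:) (simp add: distrib_left[symmetric])
qed

lemma a_middle: "a (int g + 1) = real CARD('a) * a (int g - 1)"
proof -
  have "M (int g + 1) = (real CARD('a) - 1) * (W (int g) + a (int g - 1))"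
    using cnt_s_self cnt_s[of "int g + 1" "g + 1"] by (simp add: algebra_simps)
  then have "W (int g + 1) - real CARD('a) * W (int g - 1)
      = (real CARD('a) - 1) * (W (int g) + a (int g - 1))"
    using M_eq[of "int g + 1"] by simp
  then show ?thesis
    using W_rec[of "int g + 1"] W_rec[of "int g"] by (simp add: algebra_simps)
qed

lemma cnt_low_telescope:
  assumes "g + 2 \<le> m" "int m \<le> n"
  shows "cnt D n (low m) = cnt D n (low (g + 2)) + (real CARD('a) - 1) *
    (real CARD('a) powi (n - (int m - 1)) * W (2 * (int m - 1) - n)
      - real CARD('a) powi (n - int g - 1) * W (2 * int g + 2 - n))"
  using assms
proof (induction m rule: dec_induct)
  case base
  have "n - (int (g + 2) - 1) = n - int g - 1" "2 * (int (g + 2) - 1) - n = 2 * int g + 2 - n" by auto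
  then show ?case by (simp only:) simp
next
  case (step m)
  have "real CARD('a) powi (n - (int m - 1)) = real CARD('a) powi (n - int m + 1)"
    by (simp add: algebra_simps)
  also have "\<dots> = real CARD('a) powi (n - int m) * real CARD('a)"
    by (rule power_int_add_1) simp
  finally have pw: "real CARD('a) powi (n - (int m - 1)) = real CARD('a) powi (n - int m) * real CARD('a)" .
  have W: "2 * int m - n - 2 = 2 * (int m - 1) - n" by simp
  have "real CARD('a) powi (n - int m) * M (2 * int m - n)
      = real CARD('a) powi (n - int m) * W (2 * int m - n)
        - real CARD('a) powi (n - (int m - 1)) * W (2 * (int m - 1) - n)"
    unfolding M_eq[of "2 * int m - n"] W pw by (simp add: algebra_simps)
  moreover have "cnt D n (low (Suc m)) = cnt D n (low m)
      + (real CARD('a) - 1) * (real CARD('a) powi (n - int m) * M (2 * int m - n))"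
    using cnt_low_Suc[of m n] step by simp
  moreover have "cnt D n (low m) = cnt D n (low (g + 2)) + (real CARD('a) - 1) *
    (real CARD('a) powi (n - (int m - 1)) * W (2 * (int m - 1) - n)
      - real CARD('a) powi (n - int g - 1) * W (2 * int g + 2 - n))"
    using step by simp
  moreover have "int (Suc m) - 1 = int m" by simp
  ultimately show ?case by (simp only:) (simp add: right_diff_distrib)
qed

lemma a_rec:
  assumes n: "n \<ge> int g + 2"
  shows "a n + (real CARD('a) - 1) * a (n - 1) - real CARD('a) * a (n - 2)
    = real CARD('a) powi (n - int g - 1) * (real CARD('a) * a (2 * int g - n)
      + (real CARD('a) - 1) * a (2 * int g + 1 - n) - a (2 * int g + 2 - n))"
proof -
  define Q where "Q = real CARD('a) powi (n - int g - 1)"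
  define k where "k = 2 * int g + 2 - n"
  define q where "q = real CARD('a)"
  define W0 where "W0 = W (k - 2)"
  define A0 where "A0 = a (k - 2)"
  define A1 where "A1 = a (k - 1)"
  define A2 where "A2 = a k"
  define N where "N = nat n"
  have nN: "n = int N" using n by (simp add: N_def)
  have W1: "W (k - 1) = q * W0 + A1 - A0"
    using W_rec[of "k - 1"] by (simp add: W0_def A0_def A1_def q_def)
  have W2: "W k = q * (q * W0 + A1 - A0) + A2 - A1"
    using W_rec[of k] W1 by (simp add: A1_def A2_def q_def)
  have "M n = cnt D n (low N)" using cnt_low_self[of N] nN by simp
  also have "\<dots> = cnt D n (low (g + 2)) + (q - 1) * (q powi (n - (int N - 1)) * W (2 * (int N - 1) - n) - Q * W k)"
    using cnt_low_telescope[of N n] n nN by (simp add: q_def Q_def k_def)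
  also have "2 * (int N - 1) - n = n - 2" using nN by simp
  also have "q powi (n - (int N - 1)) = q" using nN by simp
  also have "cnt D n (low (g + 2)) = (q - 2) * Q * M k + 2 * cnt D n (coset s (g + 1))"
    using cnt_low_half[of n] n by (simp add: q_def Q_def k_def)
  also have "cnt D n (coset s (g + 1)) = (q - 1) * Q * (W (k - 1) + A0)"
    using cnt_s[of n "g + 1"] n by (simp add: q_def Q_def k_def A0_def algebra_simps)
  also have "M k = W k - q * W0" using M_eq[of k] by (simp add: q_def W0_def)
  finally have "M n - (q - 1) * (q * W (n - 2))
      = Q * ((q - 2) * (W k - q * W0) + 2 * (q - 1) * (W (k - 1) + A0) - (q - 1) * W k)"
    by (simp add: algebra_simps)
  also have "(q - 2) * (W k - q * W0) + 2 * (q - 1) * (W (k - 1) + A0) - (q - 1) * W k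
      = q * A0 + (q - 1) * A1 - A2"
    unfolding W1 W2 by (simp add: algebra_simps)
  finally have "M n - (q - 1) * (q * W (n - 2)) = Q * (q * A0 + (q - 1) * A1 - A2)" .
  moreover have "M n = W n - q * W (n - 2)" using M_eq[of n] by (simp add: q_def)
  moreover have "W n = q * W (n - 1) + a n - a (n - 1)" using W_rec[of n] by (simp add: q_def)
  moreover have "W (n - 1) = q * W (n - 2) + a (n - 1) - a (n - 2)"
    using W_rec[of "n - 1"] by (simp add: q_def)
  ultimately have "a n + (q - 1) * a (n - 1) - q * a (n - 2) = Q * (q * A0 + (q - 1) * A1 - A2)"
    by (simp add: algebra_simps)
  moreover have "2 * int g - n = k - 2" "2 * int g + 1 - n = k - 1" "2 * int g + 2 - n = k"
    by (auto simp: k_def)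
  ultimately show ?thesis by (simp only: q_def Q_def A0_def A1_def A2_def)
qed

lemma functional_equation:
  "a (int g + int i) = real CARD('a) ^ i * a (int g - int i)"
proof (induction i rule: induct_nat_012)
  case (ge2 i)
  define n where "n = int g + int i + 2"
  have "n - int g - 1 = int (Suc i)" by (simp add: n_def)
  then have Q: "real CARD('a) powi (n - int g - 1) = real CARD('a) ^ Suc i" by (simp only: power_int_of_nat)
  have idx: "n - 1 = int g + int (Suc i)" "n - 2 = int g + int i" "2 * int g - n = int g - int (Suc (Suc i))"
    "2 * int g + 1 - n = int g - int (Suc i)" "2 * int g + 2 - n = int g - int i"
    by (auto simp: n_def)
  have "a n + (real CARD('a) - 1) * a (n - 1) - real CARD('a) * a (n - 2)
    = real CARD('a) powi (n - int g - 1) * (real CARD('a) * a (2 * int g - n)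
      + (real CARD('a) - 1) * a (2 * int g + 1 - n) - a (2 * int g + 2 - n))"
    by (rule a_rec) (simp add: n_def)
  then have "a n = real CARD('a) ^ Suc (Suc i) * a (int g - int (Suc (Suc i)))"
    unfolding Q idx ge2 by (simp add: algebra_simps)
  moreover have "n = int g + int (Suc (Suc i))" by (simp add: n_def)
  ultimately show ?case by simp
qed (use a_middle in simp_all)

end

lemma A_star_sum:
  fixes D :: "'a::{field,finite} poly"
  shows "(\<Sum>f\<in>monics_deg (int n). A_star D f / sqrt (pnorm f))
    = L_star_coeff D (int n) * (1 / sqrt (real CARD('a))) ^ n"
proof -
  let ?q = "real CARD('a)"
  have total: "(\<Sum>f\<in>monics_deg (int n). \<Sum>h | h \<in> monics \<and> h dvd f. pnorm h * of_int (chi D h))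
      = ?q ^ n * L_star_coeff D (int n)"
  proof -
    have "(\<Sum>f\<in>monics_deg (int n). \<Sum>h | h \<in> monics \<and> h dvd f. pnorm h * of_int (chi D h))
        = (\<Sum>m\<le>n. ?q ^ (n - m) * (\<Sum>h\<in>monics_deg (int m). pnorm h * of_int (chi D h)))"
      by (rule divisor_double_sum)
    also have "\<dots> = (\<Sum>m\<le>n. ?q ^ n * chi_sum D (int m))"
    proof (intro sum.cong refl)
      fix m assume "m \<in> {..n}"
      then have "?q ^ (n - m) * ?q ^ m = ?q ^ n" by (simp flip: power_add)
      moreover have "(\<Sum>h\<in>monics_deg (int m). pnorm h * of_int (chi D h)) = ?q ^ m * chi_sum D (int m)"
        unfolding chi_sum_def sum_distrib_left
        by (intro sum.cong refl) (auto simp: monics_deg_def pnorm_def)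
      ultimately show "?q ^ (n - m) * (\<Sum>h\<in>monics_deg (int m). pnorm h * of_int (chi D h))
          = ?q ^ n * chi_sum D (int m)" by (metis mult.assoc)
    qed
    also have "(\<Sum>m\<le>n. ?q ^ n * chi_sum D (int m)) = ?q ^ n * L_star_coeff D (int n)"
    proof -
      have "{0..int n} = int ` {..n}"
        by (simp add: atMost_atLeast0 image_int_atLeastAtMost)
      then show ?thesis
        by (simp add: L_star_coeff_def sum.reindex sum_distrib_left)
    qed
    finally show ?thesis .
  qed
  have "(\<Sum>f\<in>monics_deg (int n). A_star D f / sqrt (pnorm f))
      = (\<Sum>f\<in>monics_deg (int n). (1 / ?q ^ n / sqrt (?q ^ n)) *
          (\<Sum>h | h \<in> monics \<and> h dvd f. pnorm h * of_int (chi D h)))"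
    by (intro sum.cong refl) (simp add: A_star_def pnorm_def monics_deg_def)
  also have "\<dots> = L_star_coeff D (int n) / sqrt (?q ^ n)"
    unfolding sum_distrib_left[symmetric] total by simp
  finally show ?thesis by (simp add: real_sqrt_power power_one_over)
qed

lemma sum_monics_by_degree:
  fixes \<phi> :: "'a::{field,finite} poly \<Rightarrow> real"
  assumes "finite N"
  shows "(\<Sum>f | f \<in> monics \<and> degree f \<in> N. \<phi> f) = (\<Sum>n\<in>N. \<Sum>f\<in>monics_deg (int n). \<phi> f)"
proof -
  have "{f :: 'a poly. f \<in> monics \<and> degree f \<in> N} = (\<Union>n\<in>N. monics_deg (int n))"
    by (auto simp: monics_deg_def)
  moreover have "(\<Sum>f\<in>(\<Union>n\<in>N. monics_deg (int n)). \<phi> f) = (\<Sum>n\<in>N. \<Sum>f\<in>monics_deg (int n). \<phi> f)"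
  proof (rule sum.UNION_disjoint)
    show "\<forall>i\<in>N. \<forall>j\<in>N. i \<noteq> j \<longrightarrow> monics_deg (int i) \<inter> monics_deg (int j) = {}"
      by (auto simp: monics_deg_def)
  qed (use assms in simp_all)
  ultimately show ?thesis by simp
qed

lemma L_completed_eq:
  assumes "\<And>n. coeff p n = L_star_coeff D (int n)"
  shows "L_completed D = p"
proof -
  have "fps_of_poly p * (1 - fps_X) = L_series D"
  proof (rule fps_ext)
    fix n
    have "fps_nth (fps_of_poly p * (1 - fps_X)) n = L_star_coeff D (int n) - L_star_coeff D (int n - 1)"
      by (cases n) (simp_all add: right_diff_distrib assms L_star_coeff_neg)
    also have "\<dots> = fps_nth (L_series D) n"
      by (simp add: L_star_coeff_diff chi_sum_def L_series_def monics_deg_def)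
    finally show "fps_nth (fps_of_poly p * (1 - fps_X)) n = fps_nth (L_series D) n" .
  qed
  moreover have "1 - fps_X \<noteq> (0 :: real fps)"
  proof
    assume "1 - fps_X = (0 :: real fps)"
    then have "fps_nth (1 - fps_X :: real fps) 0 = 0" by simp
    then show False by simp
  qed
  ultimately have "fps_of_poly p = L_series D / (1 - fps_X)"
    by (metis nonzero_mult_div_cancel_right)
  then show ?thesis
    unfolding L_completed_def by (intro the_equality) (simp_all flip: fps_of_poly_eq_iff)
qed

theorem lemma2p2:
  fixes D :: "'a::{field,finite} poly" and g :: nat
  assumes "odd CARD('a)"
    and "D \<in> monic_squarefree (2 * g + 2)"
  shows "poly (L_completed D) (1 / sqrt (real CARD('a))) =
      (\<Sum>f | f \<in> monics \<and> degree f \<le> g. A_star D f / sqrt (pnorm f))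
    + (\<Sum>f | f \<in> monics \<and> degree f < g. A_star D f / sqrt (pnorm f))"
proof -
  have two: "(2::'a) \<noteq> 0" using assms(1) by (rule odd_CARD_imp_two_nonzero)
  have D: "D \<in> monics" "squarefree D" "degree D = 2 * g + 2"
    using assms(2) by (auto simp: monic_squarefree_def)
  have "degree D = 2 * (g + 1)" using D by simp
  then obtain s where s: "s \<in> monics" "degree s = g + 1" "s ^ 2 - D \<in> low (g + 1)"
    by (rule square_root_approx[OF two D(1)])
  interpret square_root_expansion D s g
    by standard (use two D s in auto)
  define x where "x = 1 / sqrt (real CARD('a))"
  have x: "real CARD('a) * x ^ 2 = 1" by (simp add: x_def power_divide)
  define p where "p = (\<Sum>n\<le>2 * g. monom (a (int n)) n)"
  have "coeff p n = a (int n)" for n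
  proof (cases "n \<le> 2 * g")
    case False
    then have "n = g + (n - g)" "n - g > g" by auto
    then obtain i where "n = g + i" "i > g" by blast
    then have "a (int n) = 0" using functional_equation[of i] by (simp add: L_star_coeff_neg)
    with False show ?thesis by (simp add: p_def coeff_sum)
  qed (simp add: p_def coeff_sum if_distrib)
  then have "L_completed D = p" by (rule L_completed_eq)
  then have "poly (L_completed D) x = (\<Sum>n\<le>2 * g. a (int n) * x ^ n)"
    by (simp add: p_def poly_sum poly_monom)
  also have "\<dots> = (\<Sum>n\<le>g. a (int n) * x ^ n) + (\<Sum>n\<in>{g<..2 * g}. a (int n) * x ^ n)"
    by (subst sum.union_disjoint[symmetric]) (auto intro!: sum.cong)
  also have "(\<Sum>n\<in>{g<..2 * g}. a (int n) * x ^ n) = (\<Sum>n<g. a (int n) * x ^ n)"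
  proof (rule sum.reindex_bij_witness[of _ "\<lambda>n. 2 * g - n" "\<lambda>n. 2 * g - n"])
    fix n assume n: "n \<in> {g<..2 * g}"
    define i where "i = n - g"
    have i: "n = g + i" "2 * g - n = g - i" "i \<le> g" using n by (auto simp: i_def)
    have "g + i = (g - i) + 2 * i" using i by simp
    then have "x ^ (g + i) = x ^ (g - i) * x ^ (2 * i)" by (simp only: power_add)
    then have "real CARD('a) ^ i * x ^ n = x ^ (g - i) * (real CARD('a) * x ^ 2) ^ i"
      by (simp add: i power_mult power_mult_distrib)
    then have "real CARD('a) ^ i * x ^ n = x ^ (g - i)" by (simp add: x)
    then show "a (int (2 * g - n)) * x ^ (2 * g - n) = a (int n) * x ^ n"
      using functional_equation[of i] i by (simp add: of_nat_diff)
  qed auto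
  also have "(\<Sum>n\<le>g. a (int n) * x ^ n) = (\<Sum>f | f \<in> monics \<and> degree f \<le> g. A_star D f / sqrt (pnorm f))"
    using sum_monics_by_degree[of "{..g}" "\<lambda>f. A_star D f / sqrt (pnorm f)"]
    by (simp add: A_star_sum x_def)
  also have "(\<Sum>n<g. a (int n) * x ^ n) = (\<Sum>f | f \<in> monics \<and> degree f < g. A_star D f / sqrt (pnorm f))"
    using sum_monics_by_degree[of "{..<g}" "\<lambda>f. A_star D f / sqrt (pnorm f)"]
    by (simp add: A_star_sum x_def)
  finally show ?thesis by (simp add: x_def)
qed

end
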